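(* Let $0<q<1$ and let $P$ be a poset on $\{x_1,\dots,x_n\}$ with labeling $\omega_n(x_i)=i$. Then for every integer $m\ge0$, \[ E_q(\Delta(P),m)=\frac{1}{(1-q)^n}V_q(\mathcal O_{[q^{m+1},1]^n}(P)), \] and equivalently \[ E_q(\Delta(P),m)=\sum_{\pi\in\mathcal L(P,\omega_n)}q^{\mathrm{maj}(\pi)}\begin{bmatrix}m+n-\mathrm{des}(\pi)\\ n\end{bmatrix}_q. \] Moreover, $E_q(\Delta(P),m)$ is a polynomial in $[m]_q$ (i.e. there is a polynomial $p(t)$ with coefficients rational functions of $q$ such that $E_q(\Delta(P),m)=p([m]_q)$ for all $m\ge0$) whose leading coefficient is the $q$-volume $V_q(\mathcal O(P))$.
   Context: $\Delta(P)$ is the set of $(x_1,\dots,x_n)\in[0,1]^n$ with $x_i\ge x_j$ whenever $x_i\le_P x_j$, and $x_i>x_j$ whenever $x_i\le_P x_j$ and $i>j$. For bounded $X\subset\mathbb R^n$, $E_q(X,m)=\sum_{(y_1,\dots,y_n)\in mX\cap\mathbb Z^n}q^{y_1+\cdots+y_n}$. For a box $I$, $\mathcal O_I(P)=\{x\in I: x_i\le x_j\text{ whenever }x_i\le_P x_j\}$ and $\mathcal O(P)=\mathcal O_{[0,1]^n}(P)$. $V_q(D)=\int_D d_qx_1\cdots d_qx_n$, the iterated $q$-integral with $x_1$ innermost and $x_n$ outermost, $x_i$ running from the minimum to the maximum of $\{y_i:y\in D,\ y_j=x_j\ \forall j>i\}$, where $\int_a^b g\,d_qx=(1-q)\sum_{i\ge0}(g(bq^i)bq^i-g(aq^i)aq^i)$.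 $\mathcal L(P,\omega_n)$ is the set of permutations $\omega_n(t_1)\cdots\omega_n(t_n)$ for linear extensions $(t_1,\dots,t_n)$ of $P$; $\mathrm{des}(\pi)$ and $\mathrm{maj}(\pi)$ are the number and sum of $i$ with $\pi_i>\pi_{i+1}$. $[m]_q=(1-q^m)/(1-q)$ and $\begin{bmatrix}N\\ n\end{bmatrix}_q$ is the $q$-binomial coefficient (zero if $N<n$).
   Formalization: "Leading coefficient" means the coefficient of [m]_q^n when E_q is written homogeneously of degree n in [m]_q and q^m; the ordinary one is q, not 1, for the one-point poset. For m=0, 0Δ(P) means Δ(P)∩{0}; with {0}, E_q=1 but both formulas give 0 for x_2<x_1. *)

theory Defs
  imports Complex_Main "HOL-Library.FuncSet" "HOL-Computational_Algebra.Polynomial"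
begin

text \<open>
  Points of \<open>\<real>\<^sup>n\<close> are the extensional functions on the index set \<open>{1..n}\<close>, so that the
  coordinates can be integrated out one after the other. The element \<open>x\<^sub>i\<close> of the poset is
  represented by its index \<open>i\<close>; a poset is a relation \<open>P\<close> with
  \<open>partial_order_on {1..n} P\<close>, where \<open>(i, j) \<in> P\<close> means \<open>x\<^sub>i \<le>\<^sub>P x\<^sub>j\<close>.
\<close>

definition cube :: "nat \<Rightarrow> real \<Rightarrow> real \<Rightarrow> (nat \<Rightarrow> real) set" where
  "cube n a b = {1..n} \<rightarrow>\<^sub>E {a..b}"

definition Delta :: "nat \<Rightarrow> (nat \<times> nat) set \<Rightarrow> (nat \<Rightarrow> real) set" where
  "Delta n P = {x \<in> cube n 0 1. \<forall>i j. (i, j) \<in> P \<longrightarrow> x i \<ge> x j \<and> (i > j \<longrightarrow> x i > x j)}"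

definition order_polytope :: "(nat \<Rightarrow> real) set \<Rightarrow> (nat \<times> nat) set \<Rightarrow> (nat \<Rightarrow> real) set" where
  "order_polytope I P = {x \<in> I. \<forall>i j. (i, j) \<in> P \<longrightarrow> x i \<le> x j}"

subsection \<open>The weighted lattice point count\<close>

text \<open>
  For \<open>m \<ge> 1\<close> the dilate is \<open>{m x | x \<in> X}\<close>. For \<open>m = 0\<close> that set would be \<open>{0}\<close> for every
  nonempty \<open>X\<close>. But \<open>\<Delta>(P)\<close> is not closed, and what is meant by \<open>0\<Delta>(P)\<close> is the set cut out
  by its (homogeneous) weak and strict inequalities in \<open>[0,0]\<^sup>n\<close>: it is empty as soon as one of
  the inequalities is strict. Hence only the points of \<open>X\<close> itself at the origin are kept for
  \<open>m = 0\<close>. The lemma \<open>dilate_Delta\<close> is the resulting uniform description. (With the literal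
  set, for the poset \<open>x\<^sub>2 < x\<^sub>1\<close> and \<open>m = 0\<close> the count would be \<open>1\<close>, while the \<open>q\<close>-volume and
  the \<open>q\<close>-binomial sum to be compared with it are \<open>0\<close>.)
\<close>

definition dilate :: "nat \<Rightarrow> nat \<Rightarrow> (nat \<Rightarrow> real) set \<Rightarrow> (nat \<Rightarrow> real) set" where
  "dilate n m X =
     (if m = 0 then X \<inter> {\<lambda>i\<in>{1..n}. 0} else (\<lambda>x. \<lambda>i\<in>{1..n}. real m * x i) ` X)"

lemma dilate_Delta:
  assumes "P \<subseteq> {1..n} \<times> {1..n}"
  shows "dilate n m (Delta n P) =
    {x \<in> cube n 0 (real m). \<forall>i j. (i, j) \<in> P \<longrightarrow> x i \<ge> x j \<and> (i > j \<longrightarrow> x i > x j)}"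
proof (cases "m = 0")
  case True
  have "cube n 0 0 = {\<lambda>i\<in>{1..n}. 0}"
    by (auto simp: cube_def PiE_def Pi_def extensional_def restrict_def fun_eq_iff)
  moreover have "(\<lambda>i\<in>{1..n}. 0) \<in> cube n 0 1"
    by (auto simp: cube_def)
  ultimately show ?thesis
    using True by (auto simp: dilate_def Delta_def)
next
  case False
  show ?thesis (is "?L = ?R")
  proof (intro equalityI subsetI)
    fix y assume "y \<in> ?L"
    then obtain x where x: "x \<in> Delta n P" and y: "y = (\<lambda>i\<in>{1..n}. real m * x i)"
      using False by (auto simp: dilate_def)
    have "y \<in> cube n 0 (real m)"
      using x unfolding y Delta_def cube_def
      by (fastforce simp: PiE_iff mult_left_le)
    then show "y \<in> ?R"
      using x assms False unfolding y Delta_def by (fastforce simp: mult_le_cancel_left)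
  next
    fix y assume y: "y \<in> ?R"
    define x where "x = (\<lambda>i\<in>{1..n}. y i / real m)"
    have "x \<in> Delta n P"
      using y assms False unfolding x_def Delta_def cube_def
      by (fastforce simp: PiE_iff divide_simps)
    moreover have "y = (\<lambda>i\<in>{1..n}. real m * x i)"
      using y False by (auto simp: x_def cube_def fun_eq_iff PiE_def extensional_def)
    ultimately show "y \<in> ?L"
      using False by (auto simp: dilate_def)
  qed
qed

definition E_q :: "real \<Rightarrow> nat \<Rightarrow> (nat \<Rightarrow> real) set \<Rightarrow> nat \<Rightarrow> real" where
  "E_q q n X m =
     (\<Sum>y | y \<in> {1..n} \<rightarrow>\<^sub>E (UNIV :: int set) \<and> (\<lambda>i\<in>{1..n}. real_of_int (y i)) \<in> dilate n m X.
        q powi (\<Sum>i\<in>{1..n}. y i))"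

subsection \<open>The iterated q-integral\<close>

definition q_integral :: "real \<Rightarrow> real \<Rightarrow> real \<Rightarrow> (real \<Rightarrow> real) \<Rightarrow> real" where
  "q_integral q a b g =
     (1 - q) * (\<Sum>i. g (b * q ^ i) * (b * q ^ i) - g (a * q ^ i) * (a * q ^ i))"

definition slice :: "nat \<Rightarrow> (nat \<Rightarrow> real) set \<Rightarrow> nat \<Rightarrow> (nat \<Rightarrow> real) \<Rightarrow> real set" where
  "slice n D i x = {y i |y. y \<in> D \<and> (\<forall>j\<in>{i<..n}. y j = x j)}"

text \<open>
  \<open>q_iter q n D i x\<close> integrates out the variables with indices \<open>1, \<dots>, i\<close>, those with indices
  \<open>i + 1, \<dots>, n\<close> being read off from \<open>x\<close>. The slices of a compact \<open>D\<close> are compact, so the infimum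
  and the supremum are the minimum and the maximum. The \<open>q\<close>-integral from \<open>a\<close> to \<open>b\<close> also evaluates
  its integrand at points below \<open>a\<close>, where the inner slices are empty; an integral over the empty
  slice is \<open>0\<close>.
\<close>

fun q_iter :: "real \<Rightarrow> nat \<Rightarrow> (nat \<Rightarrow> real) set \<Rightarrow> nat \<Rightarrow> (nat \<Rightarrow> real) \<Rightarrow> real" where
  "q_iter q n D 0 x = 1"
| "q_iter q n D (Suc i) x =
     (let S = slice n D (Suc i) x in
      if S = {} then 0
      else q_integral q (Inf S) (Sup S) (\<lambda>t. q_iter q n D i (x(Suc i := t))))"

definition V_q :: "real \<Rightarrow> nat \<Rightarrow> (nat \<Rightarrow> real) set \<Rightarrow> real" where
  "V_q q n D = q_iter q n D n (\<lambda>_. undefined)"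

subsection \<open>Linear extensions and permutation statistics\<close>

definition linear_extensions :: "nat \<Rightarrow> (nat \<times> nat) set \<Rightarrow> nat list set" where
  "linear_extensions n P =
     {t. distinct t \<and> set t = {1..n} \<and>
         (\<forall>a < length t. \<forall>b < length t. (t ! a, t ! b) \<in> P \<longrightarrow> a \<le> b)}"

definition Jordan_Hoelder :: "nat \<Rightarrow> (nat \<times> nat) set \<Rightarrow> (nat \<Rightarrow> nat) \<Rightarrow> nat list set" where
  "Jordan_Hoelder n P \<omega> = map \<omega> ` linear_extensions n P"

text \<open>Positions in a permutation are counted from \<open>1\<close>, list positions from \<open>0\<close>.\<close>

definition descents :: "nat list \<Rightarrow> nat set" where
  "descents \<pi> = {i. 1 \<le> i \<and> i < length \<pi> \<and> \<pi> ! (i - 1) > \<pi> ! i}"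

definition des :: "nat list \<Rightarrow> nat" where
  "des \<pi> = card (descents \<pi>)"

definition maj :: "nat list \<Rightarrow> nat" where
  "maj \<pi> = \<Sum>(descents \<pi>)"

subsection \<open>q-analogues\<close>

definition q_num :: "real \<Rightarrow> nat \<Rightarrow> real" where
  "q_num q m = (1 - q ^ m) / (1 - q)"

definition q_fact :: "real \<Rightarrow> nat \<Rightarrow> real" where
  "q_fact q m = (\<Prod>i\<in>{1..m}. q_num q i)"

definition q_binomial :: "real \<Rightarrow> nat \<Rightarrow> nat \<Rightarrow> real" where
  "q_binomial q N k = (if N < k then 0 else q_fact q N / (q_fact q k * q_fact q (N - k)))"

subsection \<open>Polynomials in the q-number of m\<close>

text \<open>A rational function in \<open>\<rat>(q)\<close> without poles in the interval \<open>(0,1)\<close>.\<close>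

definition rational_in_q :: "(real \<Rightarrow> real) \<Rightarrow> bool" where
  "rational_in_q c \<longleftrightarrow>
     (\<exists>a b :: rat poly. \<forall>q\<in>{0<..<1}.
        poly (map_poly of_rat b) q \<noteq> 0 \<and>
        c q = poly (map_poly of_rat a) q / poly (map_poly of_rat b) q)"

text \<open>
  The leading coefficient of a polynomial in \<open>[m]\<^sub>q\<close>. Products of factors
  \<open>[m + k]\<^sub>q = [m]\<^sub>q + q\<^sup>m [k]\<^sub>q\<close> are homogeneous in \<open>[m]\<^sub>q\<close> and \<open>q\<^sup>m = 1 - (1 - q) [m]\<^sub>q\<close>, and
  the leading coefficient that is a \<open>q\<close>-volume is the coefficient of \<open>[m]\<^sub>q\<^sup>n\<close> in this
  homogeneous form. The ordinary leading coefficient of \<open>p\<close> is a different number: for the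
  one-point poset \<open>p([m]\<^sub>q) = [m + 1]\<^sub>q = [m]\<^sub>q + q\<^sup>m\<close>, so \<open>p = 1 + q t\<close> has leading
  coefficient \<open>q\<close> as a polynomial in \<open>t\<close>, but the \<open>q\<close>-volume is \<open>1\<close>.

  The predicate says that \<open>c k\<close>, for \<open>k \<le> n\<close>, are the coefficients of \<open>p\<close> in the basis
  \<open>t^k (1 - (1 - q) t)^(n - k)\<close> of the polynomials of degree at most \<open>n\<close>; these
  coefficients are unique.
\<close>

definition homogeneous_coeffs :: "real \<Rightarrow> nat \<Rightarrow> real poly \<Rightarrow> (nat \<Rightarrow> real) \<Rightarrow> bool" where
  "homogeneous_coeffs q n p c \<longleftrightarrow>
     p = (\<Sum>k\<le>n. smult (c k) ([:0, 1:] ^ k * [:1, - (1 - q):] ^ (n - k)))"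

end

(* The q-integrals only see points whose coordinates are powers of q: with x_i = q^{y_i} the
   order polytope in [q^{m+1},1]^n becomes the set of P-partitions y with parts at most m, where
   the q-integral from a to b omits a and includes b and so makes exactly the right inequalities
   strict. Sorting a P-partition gives a unique linear extension, and each linear extension
   contributes a q-binomial coefficient. Written homogeneously in [m]_q and q^m, the leading
   coefficient is the limit of (1 - q)^n E_q(m) as m tends to infinity, that is, the q-volume of
   the whole order polytope. *)
theory Submission
  imports Defs "HOL-Analysis.Uniform_Limit"
begin

section \<open>The \<open>q\<close>-binomial coefficients\<close>

text \<open>The variables are integrated in the order of their indices, so when a coordinate is
  integrated only those with larger indices are fixed. A fixed element \<open>P\<close>-below it has
  the larger index, which is where the count demands a strict inequality; a fixed element
  \<open>P\<close>-above it demands only a weak one. The half-open grid of the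
  \<open>q\<close>-integral makes the same distinction. The grid becomes half-open by cancelling the
  tails of two infinite series below the lower limit, so the inner integrals must first be bounded
  at every grid point. The same bound dominates the series in the passage to the whole polytope. The
  top homogeneous coefficient is not evaluated over linear extensions: the count is both a form of
  degree \<open>n\<close> in \<open>[m]_q\<close> and \<open>q^m\<close> and a truncated
  \<open>q\<close>-volume, and the two limits are compared. Linear extensions show that the count is
  such a form and give the exact degree of the polynomial, a separate question because its ordinary
  leading coefficient is a different number.\<close>

lemma q_num_pos:
  assumes "0 < q" "q < 1" "0 < i"
  shows "q_num q i > 0"
  using assms by (simp add: q_num_def power_less_one_iff)

lemma q_fact_pos: "0 < q \<Longrightarrow> q < 1 \<Longrightarrow> q_fact q i > 0"
  by (auto simp: q_fact_def intro!: prod_pos q_num_pos)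

lemma q_fact_0: "q_fact q 0 = 1"
  by (simp add: q_fact_def)

lemma q_fact_Suc: "q_fact q (Suc i) = q_num q (Suc i) * q_fact q i"
  by (simp add: q_fact_def)

lemma q_num_add: "q \<noteq> 1 \<Longrightarrow> q_num q (a + b) = q_num q a + q ^ a * q_num q b"
  by (simp add: q_num_def field_simps power_add)

text \<open>The numerator factor \<open>[N+1]\<close> splits as
  \<open>[N-k] + q^(N-k) [k+1]\<close>, and each summand cancels one factor of the denominator. For
  \<open>N = k\<close> the first term on the right is zero by convention.\<close>

lemma q_binomial_Pascal:
  assumes q: "0 < q" "q < 1" and le: "k \<le> N"
  shows "q_binomial q (Suc N) (Suc k)
         = q_binomial q N (Suc k) + q ^ (N - k) * q_binomial q N k"
proof (cases "N = k")
  case True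
  then show ?thesis
    using q_fact_pos[OF q, of "Suc k"] q_fact_pos[OF q, of k]
    by (simp add: q_binomial_def q_fact_0)
next
  case False
  then obtain r where r: "N = k + Suc r"
    using le by (metis add_Suc_right le_neq_implies_less less_imp_Suc_add)
  note nz = q_fact_pos[OF q, of k] q_fact_pos[OF q, of r] q_num_pos[OF q, of "Suc k"]
    q_num_pos[OF q, of "Suc r"]
  have "q_num q (Suc N) = q_num q (Suc r) + q ^ Suc r * q_num q (Suc k)"
    using q_num_add[of q "Suc r" "Suc k"] q by (simp add: r add_ac)
  moreover have "q_binomial q (Suc N) (Suc k) = q_num q (Suc N) * q_fact q N
      / (q_num q (Suc k) * q_fact q k * (q_num q (Suc r) * q_fact q r))"
    "q_binomial q N (Suc k) = q_fact q N / (q_num q (Suc k) * q_fact q k * q_fact q r)"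
    "q_binomial q N k = q_fact q N / (q_fact q k * (q_num q (Suc r) * q_fact q r))"
    "N - k = Suc r"
    using r by (auto simp: q_binomial_def q_fact_Suc)
  ultimately have *: "q_binomial q (Suc N) (Suc k) =
      (q_num q (Suc r) + q ^ Suc r * q_num q (Suc k)) * q_fact q N
      / (q_num q (Suc k) * q_fact q k * (q_num q (Suc r) * q_fact q r))"
    "q_binomial q N (Suc k) = q_fact q N / (q_num q (Suc k) * q_fact q k * q_fact q r)"
    "q_binomial q N k = q_fact q N / (q_fact q k * (q_num q (Suc r) * q_fact q r))"
    "N - k = Suc r"
    by simp_all
  have "(x + p * y) * f / (y * g * (x * h)) = f / (y * g * h) + p * (f / (g * (x * h)))"
    if "x > 0" "y > 0" "g > 0" "h > 0" for x y f g h p :: real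
    using that by (simp add: field_simps)
  with nz show ?thesis unfolding * by blast
qed

text \<open>Pascal's rule telescopes. It supplies the weight \<open>q ^ (k + s - n)\<close>, and
  \<open>s + d = n\<close> turns this into \<open>q ^ k\<close> at the price of the constant
  \<open>q ^ d\<close>; in the application \<open>d\<close> is a number of descents.\<close>

lemma q_hockey_stick:
  assumes q: "0 < q" "q < 1" and sd: "s + d = n"
  shows "(\<Sum>k<M. q ^ k * q_binomial q (k + s) n) = q ^ d * q_binomial q (M + s) (Suc n)"
proof (induction M)
  case 0
  then show ?case using sd by (simp add: q_binomial_def)
next
  case (Suc M)
  have "q ^ M * q_binomial q (M + s) n
        = q ^ d * (q_binomial q (Suc (M + s)) (Suc n) - q_binomial q (M + s) (Suc n))"
  proof (cases "n \<le> M + s")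
    case True
    then have "d + (M + s - n) = M" using sd by simp
    then have "q ^ d * q ^ (M + s - n) = q ^ M"
      by (metis power_add)
    with q_binomial_Pascal[OF q True] show ?thesis
      by (simp add: mult.assoc[symmetric])
  next
    case False
    then show ?thesis by (simp add: q_binomial_def)
  qed
  with Suc show ?case by (simp add: algebra_simps)
qed

text \<open>The factors are the \<open>q\<close>-numbers \<open>[m+i-d]\<close>, also for negative
  \<open>m+i-d\<close>. If \<open>m < d\<close>, the factor with \<open>i = d - m\<close> vanishes,
  in agreement with the convention for the coefficient. Hence one polynomial expression serves every
  \<open>m\<close>, small values included.\<close>

lemma q_binomial_prod:
  assumes q: "0 < q" "q < 1" and dn: "d \<le> n"
  shows "q_binomial q (m + n - d) n
         = (\<Prod>i\<in>{1..n}. (1 - q ^ m * q ^ i / q ^ d) / (1 - q)) / q_fact q n"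
proof (cases "d \<le> m")
  case True
  define x where "x = m - d"
  have x: "q ^ m / q ^ d = q ^ x"
    using True q by (simp add: x_def power_diff)
  have "q_fact q (x + k) = q_fact q x * (\<Prod>i\<in>{1..k}. q_num q (x + i))" for k
    by (induction k) (auto simp: q_fact_Suc q_fact_0)
  moreover have "m + n - d = x + n" using True by (simp add: x_def)
  ultimately have "q_binomial q (m + n - d) n = (\<Prod>i\<in>{1..n}. q_num q (x + i)) / q_fact q n"
    using q_fact_pos[OF q, of x] by (simp add: q_binomial_def)
  moreover have "q_num q (x + i) = (1 - q ^ m * q ^ i / q ^ d) / (1 - q)" for i
    by (simp add: q_num_def power_add x[symmetric])
  ultimately show ?thesis by simp
next
  case False
  have "(\<Prod>i\<in>{1..n}. (1 - q ^ m * q ^ i / q ^ d) / (1 - q)) = 0"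
  proof (rule prod_zero)
    have "q ^ m * q ^ (d - m) / q ^ d = 1"
      using False q by (simp add: power_add[symmetric])
    then show "\<exists>i\<in>{1..n}. (1 - q ^ m * q ^ i / q ^ d) / (1 - q) = 0"
      using False dn by (intro bexI[of _ "d - m"]) auto
  qed simp
  then show ?thesis using False dn by (simp add: q_binomial_def)
qed

section \<open>Sequences compatible with a permutation\<close>

lemma descents_Cons2:
  "descents (a # b # r) = (if a > b then {1} else {}) \<union> Suc ` descents (b # r)"
proof -
  have "i \<in> descents (a # b # r) \<longleftrightarrow> i \<in> (if a > b then {1} else {}) \<union> Suc ` descents (b # r)" for i
  proof (cases i)
    case 0
    then show ?thesis by (auto simp: descents_def)
  next
    case (Suc j)
    then show ?thesis by (cases j) (auto simp: descents_def)
  qed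
  then show ?thesis by blast
qed

lemma finite_descents: "finite (descents t)"
  by (rule finite_subset[of _ "{..length t}"]) (auto simp: descents_def)

lemma Suc_0_notin_Suc_descents: "Suc 0 \<notin> Suc ` descents t"
  by (auto simp: descents_def)

lemma des_Cons2: "des (a # b # r) = (if a > b then 1 else 0) + des (b # r)"
  using Suc_0_notin_Suc_descents[of "b # r"] finite_descents[of "b # r"]
  by (auto simp: des_def descents_Cons2 card_image)

text \<open>Prepending an entry moves every descent one position to the right, so their sum grows by
  their number.\<close>

lemma maj_Cons2: "maj (a # b # r) = (if a > b then 1 else 0) + maj (b # r) + des (b # r)"
proof -
  have "\<Sum>(Suc ` descents (b # r)) = maj (b # r) + des (b # r)"
    by (simp add: sum.reindex maj_def des_def sum_Suc o_def)
  then show ?thesis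
    using Suc_0_notin_Suc_descents[of "b # r"] finite_descents[of "b # r"]
    by (auto simp: maj_def descents_Cons2)
qed

lemma descents_short: "length t \<le> 1 \<Longrightarrow> descents t = {}"
  by (auto simp: descents_def)

lemma des_less: "t \<noteq> [] \<Longrightarrow> des t < length t"
proof (induction t rule: induct_list012)
  case (2 x) then show ?case by (simp add: des_def descents_short)
next
  case (3 x y zs) then show ?case by (simp add: des_Cons2)
qed simp

text \<open>The bound \<open>M\<close> is exclusive, so that no subtraction is needed after a descent.\<close>

fun compatible_seqs :: "nat list \<Rightarrow> nat \<Rightarrow> nat list set" where
  "compatible_seqs [] M = {[]}"
| "compatible_seqs [a] M = (\<lambda>k. [k]) ` {..<M}"
| "compatible_seqs (a # b # r) M =
     (\<Union>k<M. (#) k ` compatible_seqs (b # r) (if a > b then k else Suc k))"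

lemma finite_compatible_seqs: "finite (compatible_seqs t M)"
  by (induction t M rule: compatible_seqs.induct) auto

text \<open>By induction the sum over the tails is a \<open>q\<close>-binomial coefficient depending
  on the head \<open>k\<close>, so the sum over \<open>k\<close> is a hockey-stick sum. The power of
  \<open>q\<close> it produces has as exponent the number of descents of the longer list, which is
  exactly the increase of \<open>maj\<close>.\<close>

lemma sum_compatible_seqs:
  assumes q: "0 < q" "q < 1" and "t \<noteq> []"
  shows "(\<Sum>ys\<in>compatible_seqs t M. q ^ sum_list ys)
         = q ^ maj t * q_binomial q (M + (length t - 1 - des t)) (length t)"
  using \<open>t \<noteq> []\<close>
proof (induction t M rule: compatible_seqs.induct)
  case (2 a M)
  have "(\<Sum>k<M. q ^ k * q_binomial q (k + 0) 0) = q ^ 0 * q_binomial q (M + 0) (Suc 0)"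
    by (rule q_hockey_stick[OF q]) simp
  moreover have "q_binomial q k 0 = 1" for k
    using q_fact_pos[OF q, of k] by (simp add: q_binomial_def q_fact_0)
  ultimately have "(\<Sum>k<M. q ^ k) = q_binomial q M (Suc 0)" by simp
  then show ?case
    by (simp add: sum.reindex inj_on_def maj_def des_def descents_short)
next
  case (3 a b r M)
  define e where "e = (if a > b then 1 else 0 :: nat)"
  define L where "L = length (b # r)"
  have d: "des (b # r) < L" unfolding L_def by (rule des_less) simp
  \<comment> \<open>Without a descent the tail may use values up to \<open>k\<close> itself, one
    more than after a descent. Absorbing this into \<open>s\<close> gives the upper index
    \<open>k + s\<close> in both cases.\<close>
  define s where "s = (if a > b then L - 1 - des (b # r) else L - des (b # r))"
  have sd: "s + (e + des (b # r)) = L"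
    using d by (auto simp: s_def e_def)
  have "(\<Sum>ys\<in>compatible_seqs (a # b # r) M. q ^ sum_list ys)
      = (\<Sum>k<M. \<Sum>ys\<in>(#) k ` compatible_seqs (b # r) (if a > b then k else Suc k). q ^ sum_list ys)"
    by (simp, rule sum.UNION_disjoint) (auto simp: finite_compatible_seqs)
  also have "\<dots> = (\<Sum>k<M. q ^ k *
      (\<Sum>ys\<in>compatible_seqs (b # r) (if a > b then k else Suc k). q ^ sum_list ys))"
    by (simp add: sum.reindex power_add sum_distrib_left)
  also have "\<dots> = (\<Sum>k<M. q ^ k * (q ^ maj (b # r) * q_binomial q (k + s) L))"
  proof (rule sum.cong)
    fix k assume k: "k \<in> {..<M}"
    have "(if a > b then k else Suc k) + (length (b # r) - 1 - des (b # r)) = k + s"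
      using d by (auto simp: s_def L_def)
    then show "q ^ k * (\<Sum>ys\<in>compatible_seqs (b # r) (if a > b then k else Suc k). q ^ sum_list ys)
        = q ^ k * (q ^ maj (b # r) * q_binomial q (k + s) L)"
      using 3(1)[OF k] by (simp add: L_def split: if_splits)
  qed simp
  also have "\<dots> = q ^ maj (b # r) * (\<Sum>k<M. q ^ k * q_binomial q (k + s) L)"
    by (simp add: sum_distrib_left mult_ac)
  also have "\<dots> = q ^ maj (b # r) * (q ^ (e + des (b # r)) * q_binomial q (M + s) (Suc L))"
    by (simp add: q_hockey_stick[OF q sd])
  also have "\<dots> = q ^ maj (a # b # r) *
      q_binomial q (M + (length (a # b # r) - 1 - des (a # b # r))) (length (a # b # r))"
  proof -
    have "maj (a # b # r) = maj (b # r) + (e + des (b # r))"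
      by (simp add: maj_Cons2 e_def)
    moreover have "s = length (a # b # r) - 1 - des (a # b # r)" "Suc L = length (a # b # r)"
      by (auto simp: des_Cons2 s_def L_def)
    ultimately show ?thesis by (simp add: power_add)
  qed
  finally show ?case .
qed simp

text \<open>A pair holds an index and its value. Breaking ties by the index makes values drop
  strictly wherever the index drops, that is, at the descents of the permutation.\<close>

definition weakly_before :: "nat \<times> nat \<Rightarrow> nat \<times> nat \<Rightarrow> bool" where
  "weakly_before x y \<longleftrightarrow> snd y < snd x \<or> snd y = snd x \<and> fst x \<le> fst y"

lemma transp_weakly_before: "transp weakly_before"
  by (auto simp: transp_def weakly_before_def)

text \<open>The recursion compares only neighbours, through the bound handed to the tail;
  transitivity of \<open>weakly_before\<close> upgrades this to all pairs of positions.\<close>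

lemma compatible_seqs_eq:
  "compatible_seqs t M = {ys. length ys = length t \<and> (\<forall>v\<in>set ys. v < M) \<and>
     sorted_wrt weakly_before (zip t ys)}"
proof (induction t M rule: compatible_seqs.induct)
  case (2 a M)
  then show ?case by (auto simp: length_Suc_conv)
next
  case (3 a b r M)
  have *: "k # v # vs \<in> compatible_seqs (a # b # r) M \<longleftrightarrow>
    length vs = length r \<and> (\<forall>w\<in>set (k # v # vs). w < M) \<and>
    sorted_wrt weakly_before ((a, k) # (b, v) # zip r vs)" for k v vs
  proof -
    define e where "e = (if a > b then k else Suc k)"
    have le: "w \<le> v" if len: "length vs = length r"
      and sorted: "sorted_wrt weakly_before ((b, v) # zip r vs)" and w: "w \<in> set vs" for w
    proof -
      obtain j where "j < length vs" "vs ! j = w"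
        using w by (auto simp: in_set_conv_nth)
      then have "(r ! j, w) \<in> set (zip r vs)"
        using len by (auto simp: in_set_zip)
      then show ?thesis using sorted by (auto simp: weakly_before_def)
    qed
    have "k # v # vs \<in> compatible_seqs (a # b # r) M \<longleftrightarrow>
        k < M \<and> v # vs \<in> compatible_seqs (b # r) e"
      by (auto simp: e_def)
    also have "\<dots> \<longleftrightarrow> k < M \<and> length vs = length r \<and> (\<forall>w\<in>set (v # vs). w < e) \<and>
        sorted_wrt weakly_before ((b, v) # zip r vs)"
      using 3[of k] by (auto simp: e_def)
    also have "\<dots> \<longleftrightarrow> k < M \<and> length vs = length r \<and> weakly_before (a, k) (b, v) \<and>
        sorted_wrt weakly_before ((b, v) # zip r vs)"
    \<comment> \<open>Values along a sorted tail never exceed its first entry, so the bound on the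
      whole tail is a bound on \<open>v\<close> alone, and that is the comparison of
      \<open>v\<close> with \<open>k\<close>.\<close>
    proof -
      have "(\<forall>w\<in>set (v # vs). w < e) \<longleftrightarrow> v < e"
        if "length vs = length r" "sorted_wrt weakly_before ((b, v) # zip r vs)"
        using le[OF that] by (auto intro: le_less_trans)
      moreover have "v < e \<longleftrightarrow> weakly_before (a, k) (b, v)"
        by (auto simp: e_def weakly_before_def)
      ultimately show ?thesis by blast
    qed
    also have "\<dots> \<longleftrightarrow> length vs = length r \<and> (\<forall>w\<in>set (k # v # vs). w < M) \<and>
        weakly_before (a, k) (b, v) \<and> sorted_wrt weakly_before ((b, v) # zip r vs)"
    proof -
      have "\<forall>w\<in>set (k # v # vs). w < M"
        if "length vs = length r" "sorted_wrt weakly_before ((b, v) # zip r vs)"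
          "weakly_before (a, k) (b, v)" "k < M"
      proof -
        have "v \<le> k" using that by (auto simp: weakly_before_def)
        with le[OF that(1,2)] that(4) show ?thesis by fastforce
      qed
      then show ?thesis by auto
    qed
    finally show ?thesis
      by (simp add: sorted_wrt2[OF transp_weakly_before] del: sorted_wrt.simps)
  qed
  show ?case
  proof (intro set_eqI)
    fix ys
    show "ys \<in> compatible_seqs (a # b # r) M \<longleftrightarrow> ys \<in> {ys. length ys = length (a # b # r) \<and>
      (\<forall>v\<in>set ys. v < M) \<and> sorted_wrt weakly_before (zip (a # b # r) ys)}"
    proof (cases "\<exists>k v vs. ys = k # v # vs")
      case True
      then obtain k v vs where "ys = k # v # vs" by blast
      then show ?thesis
        using *[of k v vs] by (simp del: compatible_seqs.simps sorted_wrt.simps)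
    next
      case False
      have "length ys = length (a # b # r)" if "ys \<in> compatible_seqs (a # b # r) M"
        using that 3 by (auto split: if_splits)
      with False show ?thesis
        by (auto simp: length_Suc_conv simp del: compatible_seqs.simps)
    qed
  qed
qed auto

section \<open>\<open>P\<close>-partitions\<close>

text \<open>With the exclusive bound, parts at most \<open>m\<close> mean \<open>M = Suc m\<close>,
  which matches the lower limit \<open>q ^ (m + 1)\<close> of the cube: \<open>q ^ M < q ^ k\<close>
  holds exactly for \<open>k < M\<close>.\<close>

definition P_partitions :: "nat \<Rightarrow> (nat \<times> nat) set \<Rightarrow> nat \<Rightarrow> (nat \<Rightarrow> nat) set" where
  "P_partitions n P M =
     {z \<in> {1..n} \<rightarrow>\<^sub>E {..<M}. \<forall>i j. (i, j) \<in> P \<longrightarrow> z j \<le> z i \<and> (j < i \<longrightarrow> z j < z i)}"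

lemma finite_P_partitions: "finite (P_partitions n P M)"
  by (rule finite_subset[of _ "{1..n} \<rightarrow>\<^sub>E {..<M}"]) (auto simp: P_partitions_def intro: finite_PiE)

lemma E_q_Delta:
  assumes P: "P \<subseteq> {1..n} \<times> {1..n}" and q: "q > 0"
  shows "E_q q n (Delta n P) m = (\<Sum>z\<in>P_partitions n P (Suc m). q ^ (\<Sum>i\<in>{1..n}. z i))"
  unfolding E_q_def dilate_Delta[OF P]
proof (rule sum.reindex_bij_witness[of _ "\<lambda>z. \<lambda>i\<in>{1..n}. int (z i)" "\<lambda>y. \<lambda>i\<in>{1..n}. nat (y i)"])
  fix y
  assume "y \<in> {y. y \<in> {1..n} \<rightarrow>\<^sub>E (UNIV :: int set) \<and> (\<lambda>i\<in>{1..n}. real_of_int (y i))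
     \<in> {x \<in> cube n 0 (real m). \<forall>i j. (i, j) \<in> P \<longrightarrow> x i \<ge> x j \<and> (i > j \<longrightarrow> x i > x j)}}"
  then have y: "y \<in> {1..n} \<rightarrow>\<^sub>E (UNIV :: int set)"
    and cube: "(\<lambda>i\<in>{1..n}. real_of_int (y i)) \<in> cube n 0 (real m)"
    and mono: "\<forall>i j. (i, j) \<in> P \<longrightarrow> (\<lambda>i\<in>{1..n}. real_of_int (y i)) i \<ge> (\<lambda>i\<in>{1..n}. real_of_int (y i)) j
      \<and> (i > j \<longrightarrow> (\<lambda>i\<in>{1..n}. real_of_int (y i)) i > (\<lambda>i\<in>{1..n}. real_of_int (y i)) j)"
    by simp_all
  have b: "0 \<le> y i \<and> y i \<le> int m" if "i \<in> {1..n}" for i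
    using cube that of_int_le_iff[of "y i" "int m", where 'a = real] by (auto simp: cube_def PiE_iff)
  have c: "y j \<le> y i \<and> (j < i \<longrightarrow> y j < y i)" if "(i, j) \<in> P" for i j
    using mono[rule_format, OF that] that P by auto
  show "(\<lambda>i\<in>{1..n}. int ((\<lambda>i\<in>{1..n}. nat (y i)) i)) = y"
    using y b by (auto simp: fun_eq_iff PiE_iff extensional_def)
  have "nat (y j) \<le> nat (y i) \<and> (j < i \<longrightarrow> nat (y j) < nat (y i))" if "(i, j) \<in> P" for i j
    using c[OF that] b[of j] b[of i] P that by auto
  then show "(\<lambda>i\<in>{1..n}. nat (y i)) \<in> P_partitions n P (Suc m)"
    using b P by (fastforce simp: P_partitions_def PiE_iff)
  have "(\<Sum>i\<in>{1..n}. y i) = int (\<Sum>i\<in>{1..n}. (\<lambda>i\<in>{1..n}. nat (y i)) i)"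
    unfolding of_nat_sum using b by (intro sum.cong) auto
  then show "q ^ (\<Sum>i\<in>{1..n}. (\<lambda>i\<in>{1..n}. nat (y i)) i) = q powi (\<Sum>i\<in>{1..n}. y i)"
    by (metis power_int_of_nat)
next
  fix z assume z: "z \<in> P_partitions n P (Suc m)"
  then show "(\<lambda>i\<in>{1..n}. nat ((\<lambda>i\<in>{1..n}. int (z i)) i)) = z"
    by (auto simp: fun_eq_iff P_partitions_def PiE_iff extensional_def)
  have "\<And>i. i \<in> {1..n} \<Longrightarrow> z i \<le> m"
    using z by (auto simp: P_partitions_def PiE_iff less_Suc_eq_le)
  then show "(\<lambda>i\<in>{1..n}. int (z i)) \<in> {y. y \<in> {1..n} \<rightarrow>\<^sub>E (UNIV :: int set) \<and>
      (\<lambda>i\<in>{1..n}. real_of_int (y i))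
     \<in> {x \<in> cube n 0 (real m). \<forall>i j. (i, j) \<in> P \<longrightarrow> x i \<ge> x j \<and> (i > j \<longrightarrow> x i > x j)}}"
    using z P by (fastforce simp: cube_def PiE_iff P_partitions_def)
qed

section \<open>Sorting permutations and the decomposition by linear extensions\<close>

definition sorted_along :: "nat list \<Rightarrow> (nat \<Rightarrow> nat) \<Rightarrow> bool" where
  "sorted_along t z \<longleftrightarrow> sorted_wrt weakly_before (map (\<lambda>i. (i, z i)) t)"

text \<open>On \<open>{1..n}\<close> the order by decreasing value, ties broken by the index, is the order of the
  integers \<open>i - (n + 1) z\<^sub>i\<close>; so sorting by this key gives the permutation along which \<open>z\<close> is sorted.\<close>

lemma sort_key_le_iff:
  assumes "i \<in> {1..n}" "j \<in> {1..n}"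
  shows "int i - int (z i) * int (Suc n) \<le> int j - int (z j) * int (Suc n)
    \<longleftrightarrow> weakly_before (i, z i) (j, z j)"
proof -
  have *: "int i - int u * int (Suc n) < int j - int v * int (Suc n)"
    if "v < u" "i \<in> {1..n}" "j \<in> {1..n}" for i j u v
  proof -
    have "int (v + 1) * int (Suc n) \<le> int u * int (Suc n)"
      using that by (intro mult_right_mono) auto
    then show ?thesis using that by (auto simp: algebra_simps)
  qed
  consider "z j < z i" | "z j = z i" | "z i < z j" by linarith
  then show ?thesis
    using *[of "z j" "z i" i j] *[of "z i" "z j" j i] assms
    by cases (auto simp: weakly_before_def)
qed

text \<open>Existence is sorting by the key. For uniqueness, equal keys give
  \<open>weakly_before\<close> in both directions and hence equal indices, so the key is injective;
  a sorted list without repetitions is determined by its set.\<close>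

lemma ex1_sorted_along:
  "\<exists>!t. distinct t \<and> set t = {1..n} \<and> sorted_along t z"
proof -
  define key where "key i = int i - int (z i) * int (Suc n)" for i
  have key: "key i \<le> key j \<longleftrightarrow> weakly_before (i, z i) (j, z j)"
    if "i \<in> {1..n}" "j \<in> {1..n}" for i j
    unfolding key_def by (rule sort_key_le_iff[OF that])
  have inj: "inj_on key {1..n}"
  proof (rule inj_onI)
    fix i j assume "i \<in> {1..n}" "j \<in> {1..n}" "key i = key j"
    with key[of i j] key[of j i] show "i = j" by (auto simp: weakly_before_def)
  qed
  have srt: "sorted_along t z \<longleftrightarrow> sorted (map key t)" if t: "set t = {1..n}" for t
    unfolding sorted_along_def sorted_wrt_map
  proof
    assume "sorted_wrt (\<lambda>x y. weakly_before (x, z x) (y, z y)) t"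
    then show "sorted_wrt (\<lambda>x y. key x \<le> key y) t"
      by (rule sorted_wrt_mono_rel[rotated]) (use key t in auto)
  next
    assume "sorted_wrt (\<lambda>x y. key x \<le> key y) t"
    then show "sorted_wrt (\<lambda>x y. weakly_before (x, z x) (y, z y)) t"
      by (rule sorted_wrt_mono_rel[rotated]) (use key t in auto)
  qed
  show ?thesis
  proof (rule ex1I)
    have "set (sort_key key [1..<Suc n]) = {1..n}" by auto
    then show "distinct (sort_key key [1..<Suc n]) \<and> set (sort_key key [1..<Suc n]) = {1..n} \<and>
      sorted_along (sort_key key [1..<Suc n]) z"
      using srt[of "sort_key key [1..<Suc n]"] by simp
  next
    fix t assume t: "distinct t \<and> set t = {1..n} \<and> sorted_along t z"
    let ?s = "sort_key key [1..<Suc n]"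
    have s: "set ?s = {1..n}" by auto
    have "map key t = map key ?s"
    proof (rule sorted_distinct_set_unique)
      show "sorted (map key t)" using t srt by blast
      show "distinct (map key t)" using t inj by (simp add: distinct_map)
      show "sorted (map key ?s)" by simp
      show "distinct (map key ?s)" using inj s by (simp only: distinct_map) simp
      show "set (map key t) = set (map key ?s)" using t s by (simp only: set_map)
    qed
    then show "t = ?s"
      by (rule map_inj_on) (use t s inj in simp)
  qed
qed

text \<open>Stanley's fundamental lemma on \<open>P\<close>-partitions. For each
  \<open>(i, j)\<close> in \<open>P\<close> the defining condition is precisely
  \<open>weakly_before (i, z i) (j, z j)\<close>, so \<open>z\<close> is a
  \<open>P\<close>-partition iff its sorting permutation lists related elements in the order of
  \<open>P\<close>.\<close>

lemma P_partitions_eq_UN: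
  assumes P: "P \<subseteq> {1..n} \<times> {1..n}"
  shows "P_partitions n P M = (\<Union>t\<in>linear_extensions n P. {z \<in> {1..n} \<rightarrow>\<^sub>E {..<M}. sorted_along t z})"
proof (intro equalityI subsetI)
  fix z assume z: "z \<in> P_partitions n P M"
  obtain t where t: "distinct t" "set t = {1..n}" "sorted_along t z"
    using ex1_sorted_along by blast
  have "a \<le> b" if ab: "a < length t" "b < length t" "(t ! a, t ! b) \<in> P" for a b
  proof (rule ccontr)
    assume "\<not> a \<le> b"
    then have "weakly_before (t ! b, z (t ! b)) (t ! a, z (t ! a))"
      using t(3) ab by (auto simp: sorted_along_def sorted_wrt_map sorted_wrt_iff_nth_less)
    moreover have "z (t ! b) \<le> z (t ! a)" "t ! b < t ! a \<longrightarrow> z (t ! b) < z (t ! a)"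
      using z ab(3) by (auto simp: P_partitions_def)
    ultimately have "t ! a = t ! b"
      by (auto simp: weakly_before_def)
    with t(1) ab \<open>\<not> a \<le> b\<close> show False by (simp add: nth_eq_iff_index_eq)
  qed
  with t have "t \<in> linear_extensions n P" by (auto simp: linear_extensions_def)
  with t z show "z \<in> (\<Union>t\<in>linear_extensions n P. {z \<in> {1..n} \<rightarrow>\<^sub>E {..<M}. sorted_along t z})"
    by (auto simp: P_partitions_def)
next
  fix z assume "z \<in> (\<Union>t\<in>linear_extensions n P. {z \<in> {1..n} \<rightarrow>\<^sub>E {..<M}. sorted_along t z})"
  then obtain t where t: "t \<in> linear_extensions n P" and z: "z \<in> {1..n} \<rightarrow>\<^sub>E {..<M}"
    and s: "sorted_along t z" by blast
  have "z j \<le> z i \<and> (j < i \<longrightarrow> z j < z i)" if ij: "(i, j) \<in> P" for i j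
  proof -
    have "i \<in> set t" "j \<in> set t" using t ij P by (auto simp: linear_extensions_def)
    then obtain a b where ab: "a < length t" "b < length t" "i = t ! a" "j = t ! b"
      by (metis in_set_conv_nth)
    then have "a \<le> b" using t ij by (auto simp: linear_extensions_def)
    then consider "a = b" | "a < b" by linarith
    then show ?thesis
    proof cases
      case 2
      then have "weakly_before (i, z i) (j, z j)"
        using s ab by (auto simp: sorted_along_def sorted_wrt_map sorted_wrt_iff_nth_less)
      then show ?thesis by (auto simp: weakly_before_def)
    qed (use ab in simp)
  qed
  with z show "z \<in> P_partitions n P M" by (auto simp: P_partitions_def)
qed

lemma sum_sorted_along:
  assumes t: "distinct t" "set t = {1..n}"
  shows "(\<Sum>z | z \<in> {1..n} \<rightarrow>\<^sub>E {..<M} \<and> sorted_along t z. q ^ (\<Sum>i\<in>{1..n}. z i))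
       = (\<Sum>ys\<in>compatible_seqs t M. (q::real) ^ sum_list ys)"
proof -
  let ?S = "{z. z \<in> {1..n} \<rightarrow>\<^sub>E {..<M} \<and> sorted_along t z}"
  have zip: "zip t (map z t) = map (\<lambda>i. (i, z i)) t" for z :: "nat \<Rightarrow> nat"
    by (induction t) auto
  have "inj_on (\<lambda>z. map z t) ?S"
  proof (rule inj_onI)
    fix x y assume "x \<in> ?S" "y \<in> ?S" "map x t = map y t"
    moreover from this have "x i = y i" if "i \<in> {1..n}" for i
      using that t by (metis map_eq_conv)
    ultimately show "x = y" by (blast intro: PiE_ext)
  qed
  moreover have "(\<lambda>z. map z t) ` ?S = compatible_seqs t M"
  proof (intro equalityI subsetI)
    fix ys assume "ys \<in> (\<lambda>z. map z t) ` ?S"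
    then show "ys \<in> compatible_seqs t M"
      using t by (auto simp: compatible_seqs_eq zip sorted_along_def PiE_iff)
  next
    fix ys assume ys: "ys \<in> compatible_seqs t M"
    then have len: "length ys = length t" by (simp add: compatible_seqs_eq)
    \<comment> \<open>The inverse of reading off values along \<open>t\<close>: a lookup in the
      table that pairs \<open>t\<close> with \<open>ys\<close>.\<close>
    define z where "z = (\<lambda>i\<in>{1..n}. the (map_of (zip t ys) i))"
    have m: "map z t = ys"
    proof (rule nth_equalityI)
      fix j assume j: "j < length (map z t)"
      then have "t ! j \<in> {1..n}" using t(2) nth_mem by fastforce
      then show "map z t ! j = ys ! j"
        using j len t by (simp add: z_def map_of_zip_nth)
    qed (simp add: len)
    have "z i < M" if "i \<in> {1..n}" for i
    proof -
      have "z i \<in> set (map z t)" using that t by simp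
      then show ?thesis using ys m by (simp add: compatible_seqs_eq)
    qed
    then have "z \<in> {1..n} \<rightarrow>\<^sub>E {..<M}"
      by (auto simp: PiE_iff z_def)
    moreover have "sorted_along t z"
      using ys m zip[of z] by (simp add: compatible_seqs_eq sorted_along_def)
    ultimately show "ys \<in> (\<lambda>z. map z t) ` ?S" using m by blast
  qed
  ultimately have "(\<Sum>ys\<in>compatible_seqs t M. q ^ sum_list ys) = (\<Sum>z\<in>?S. q ^ sum_list (map z t))"
    by (metis (no_types, lifting) sum.reindex_cong)
  then show ?thesis
    using t by (simp add: sum_list_distinct_conv_sum_set)
qed

lemma finite_linear_extensions: "finite (linear_extensions n P)"
proof (rule finite_subset)
  show "linear_extensions n P \<subseteq> {t. set t \<subseteq> {1..n} \<and> length t = n}"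
    by (auto simp: linear_extensions_def distinct_card[symmetric])
qed (simp add: finite_lists_length_eq)

lemma linear_extensionsD:
  assumes "t \<in> linear_extensions n P"
  shows "distinct t" "set t = {1..n}" "length t = n" "des t \<le> n"
proof -
  show *: "distinct t" "set t = {1..n}" using assms by (auto simp: linear_extensions_def)
  then show **: "length t = n" by (metis distinct_card card_atLeastAtMost diff_Suc_1)
  show "des t \<le> n" using des_less[of t] ** by (cases "t = []") (auto simp: des_def descents_def)
qed

lemma sum_P_partitions:
  assumes P: "P \<subseteq> {1..n} \<times> {1..n}" and q: "0 < q" "q < 1"
  shows "(\<Sum>z\<in>P_partitions n P (Suc m). q ^ (\<Sum>i\<in>{1..n}. z i))
       = (\<Sum>t\<in>linear_extensions n P. q ^ maj t * q_binomial q (m + n - des t) n)"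
proof -
  have "(\<Sum>z\<in>P_partitions n P (Suc m). q ^ (\<Sum>i\<in>{1..n}. z i))
      = (\<Sum>t\<in>linear_extensions n P. \<Sum>z | z \<in> {1..n} \<rightarrow>\<^sub>E {..<Suc m} \<and> sorted_along t z.
          q ^ (\<Sum>i\<in>{1..n}. z i))"
    unfolding P_partitions_eq_UN[OF P]
  proof (rule sum.UNION_disjoint[OF finite_linear_extensions])
    show "\<forall>t\<in>linear_extensions n P. finite {z \<in> {1..n} \<rightarrow>\<^sub>E {..<Suc m}. sorted_along t z}"
      by (intro ballI finite_subset[OF _ finite_PiE[of "{1..n}" "\<lambda>_. {..<Suc m}"]]) auto
    show "\<forall>s\<in>linear_extensions n P. \<forall>t\<in>linear_extensions n P. s \<noteq> t \<longrightarrow>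
       {z \<in> {1..n} \<rightarrow>\<^sub>E {..<Suc m}. sorted_along s z} \<inter> {z \<in> {1..n} \<rightarrow>\<^sub>E {..<Suc m}. sorted_along t z} = {}"
      using ex1_sorted_along linear_extensionsD(1,2) by blast
  qed
  also have "\<dots> = (\<Sum>t\<in>linear_extensions n P. q ^ maj t * q_binomial q (m + n - des t) n)"
  proof (rule sum.cong)
    fix t assume "t \<in> linear_extensions n P"
    note t = linear_extensionsD[OF this]
    have "(\<Sum>ys\<in>compatible_seqs t (Suc m). q ^ sum_list ys)
        = q ^ maj t * q_binomial q (m + n - des t) n"
    proof (cases "t = []")
      case True
      then have "n = 0" using t by simp
      with True show ?thesis
        using q_fact_pos[OF q, of m]
        by (simp add: maj_def des_def descents_short q_binomial_def q_fact_0)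
    next
      case False
      \<comment> \<open>The extra one in the exclusive bound compensates the \<open>n - 1\<close>;
        \<open>des t < n\<close> keeps the natural subtraction exact.\<close>
      then have *: "Suc m + (n - 1 - des t) = m + n - des t"
        using des_less[of t] t by simp
      show ?thesis
        using sum_compatible_seqs[OF q False, of "Suc m"] unfolding t(3) * .
    qed
    then show "(\<Sum>z | z \<in> {1..n} \<rightarrow>\<^sub>E {..<Suc m} \<and> sorted_along t z. q ^ (\<Sum>i\<in>{1..n}. z i))
        = q ^ maj t * q_binomial q (m + n - des t) n"
      by (simp only: sum_sorted_along[OF t(1,2)])
  qed simp
  finally show ?thesis .
qed

text \<open>Counting the elements strictly above gives a \<open>P\<close>-partition, and the permutation along
  which it is sorted is a linear extension.\<close>

lemma linear_extensions_nonempty: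
  assumes "partial_order_on {1..n} P"
  shows "linear_extensions n P \<noteq> {}"
proof -
  have P: "P \<subseteq> {1..n} \<times> {1..n}" and tr: "trans P" and as: "antisym P"
    using assms by (auto simp: partial_order_on_def preorder_on_def)
  define U where "U i = {k. (i, k) \<in> P \<and> k \<noteq> i}" for i
  have fin: "finite (U i)" for i
    by (rule finite_subset[of _ "{1..n}"]) (use P in \<open>auto simp: U_def\<close>)
  define z where "z = (\<lambda>i\<in>{1..n}. card (U i))"
  have lt: "card (U j) < card (U i)" if "(i, j) \<in> P" "i \<noteq> j" for i j
  proof (rule psubset_card_mono[OF fin])
    have "U j \<subseteq> U i" using that tr as by (auto simp: U_def dest: transD antisymD)
    moreover have "j \<in> U i - U j" using that by (auto simp: U_def)
    ultimately show "U j \<subset> U i" by blast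
  qed
  have "z i < Suc n" if "i \<in> {1..n}" for i
    using that card_mono[of "{1..n}" "U i"] P by (auto simp: z_def U_def less_Suc_eq_le)
  moreover have "z j \<le> z i \<and> (j < i \<longrightarrow> z j < z i)" if "(i, j) \<in> P" for i j
    using that lt[OF that] P by (cases "i = j") (auto simp: z_def)
  ultimately have "z \<in> P_partitions n P (Suc n)"
    by (auto simp: P_partitions_def PiE_iff z_def)
  then show ?thesis unfolding P_partitions_eq_UN[OF P] by blast
qed

section \<open>The \<open>q\<close>-integral over the order polytope\<close>

lemma suminf_from:
  fixes f :: "nat \<Rightarrow> real"
  assumes "summable f"
  shows "summable (\<lambda>k. if u \<le> k then f k else 0)" "(\<Sum>k. if u \<le> k then f k else 0) = (\<Sum>i. f (i + u))"
proof -
  show *: "summable (\<lambda>k. if u \<le> k then f k else 0)"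
    by (rule iffD1[OF summable_cong[of f] assms]) (auto simp: eventually_at_top_linorder)
  show "(\<Sum>k. if u \<le> k then f k else 0) = (\<Sum>i. f (i + u))"
    using suminf_split_initial_segment[OF *, of u] by simp
qed

text \<open>Between powers of \<open>q\<close> the two geometric grids in the \<open>q\<close>-integral cancel below the lower limit.\<close>

lemma q_integral_powers:
  assumes q: "0 < q" "q < 1" and bound: "\<And>k. \<bar>g (q ^ k)\<bar> \<le> B"
    and a: "a = 0 \<or> (\<exists>v. a = q ^ v)" and b: "\<exists>u. b = q ^ u" and ab: "a \<le> b"
  shows "q_integral q a b g
         = (1 - q) * (\<Sum>k. if a < q ^ k \<and> q ^ k \<le> b then q ^ k * g (q ^ k) else 0)"
proof -
  obtain u where u: "b = q ^ u" using b by blast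
  define f where "f k = q ^ k * g (q ^ k)" for k
  have f: "summable f"
  proof (rule summable_comparison_test')
    show "summable (\<lambda>k. q ^ k * B)"
      using q by (intro summable_mult2 summable_geometric) auto
    show "norm (f k) \<le> q ^ k * B" if "k \<ge> 0" for k
      unfolding f_def using bound[of k] q by (simp add: abs_mult mult_left_mono)
  qed
  note u_sum = suminf_from[OF f, of u]
  have le: "q ^ k \<le> q ^ j \<longleftrightarrow> j \<le> k" for j k
    using q by (simp add: power_decreasing_iff)
  have lt: "q ^ k < q ^ j \<longleftrightarrow> j < k" for j k
    using q by (simp add: power_strict_decreasing_iff)
  from a show ?thesis
  proof
    assume a: "a = 0"
    have "q_integral q a b g = (1 - q) * (\<Sum>i. f (i + u))"
      by (simp add: q_integral_def a u f_def power_add mult_ac)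
    also have "\<dots> = (1 - q) * (\<Sum>k. if u \<le> k then f k else 0)" using u_sum by simp
    also have "(\<lambda>k. if u \<le> k then f k else 0) = (\<lambda>k. if a < q ^ k \<and> q ^ k \<le> b then q ^ k * g (q ^ k) else 0)"
      using q by (auto simp: fun_eq_iff a u le f_def)
    finally show ?thesis .
  next
    assume "\<exists>v. a = q ^ v"
    then obtain v where v: "a = q ^ v" by blast
    note v_sum = suminf_from[OF f, of v]
    have uv: "u \<le> v" using ab u v le by simp
    have "q_integral q a b g = (1 - q) * (\<Sum>i. f (i + u) - f (i + v))"
      by (simp add: q_integral_def v u f_def power_add mult_ac)
    also have "(\<Sum>i. f (i + u) - f (i + v)) = (\<Sum>i. f (i + u)) - (\<Sum>i. f (i + v))"
      by (rule suminf_diff[symmetric]) (use f in \<open>simp_all add: summable_iff_shift\<close>)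
    also have "\<dots> = (\<Sum>k. (if u \<le> k then f k else 0) - (if v \<le> k then f k else 0))"
      using suminf_diff[OF u_sum(1) v_sum(1)] u_sum(2) v_sum(2) by simp
    also have "\<dots> = (\<Sum>k. if a < q ^ k \<and> q ^ k \<le> b then q ^ k * g (q ^ k) else 0)"
      using uv by (intro arg_cong[where f = suminf]) (auto simp: fun_eq_iff u v le lt f_def)
    finally show ?thesis .
  qed
qed

section \<open>Slices of the order polytope and the recursion in one variable\<close>

definition order_preserving_on ::
  "real \<Rightarrow> (nat \<times> nat) set \<Rightarrow> nat set \<Rightarrow> (nat \<Rightarrow> real) \<Rightarrow> bool" where
  "order_preserving_on l P J x \<longleftrightarrow> (\<forall>j\<in>J. l \<le> x j \<and> x j \<le> 1) \<and>
     (\<forall>i\<in>J. \<forall>j\<in>J. (i, j) \<in> P \<longrightarrow> x i \<le> x j)"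

text \<open>Each missing element receives the largest value forced from below. The slices are
  defined through full points of the polytope, so partially fixed coordinates must be known to be
  completable.\<close>

lemma order_preserving_on_extend:
  assumes P: "partial_order_on {1..n} P" and J: "J \<subseteq> {1..n}" and l: "l \<le> 1"
    and x: "order_preserving_on l P J x"
  shows "\<exists>y\<in>order_polytope (cube n l 1) P. \<forall>j\<in>J. y j = x j"
proof -
  have sub: "P \<subseteq> {1..n} \<times> {1..n}" and tr: "trans P" and re: "\<And>i. i \<in> {1..n} \<Longrightarrow> (i, i) \<in> P"
    using P by (auto simp: partial_order_on_def preorder_on_def refl_on_def)
  have fJ: "finite J" using J finite_subset by blast
  define U where "U h = insert l (x ` {j \<in> J. (j, h) \<in> P})" for h
  have fU: "finite (U h)" "U h \<noteq> {}" for h using fJ by (auto simp: U_def)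
  define y where "y = (\<lambda>h\<in>{1..n}. Max (U h))"
  have "l \<le> Max (U h)" "Max (U h) \<le> 1" for h
    using fU[of h] l x by (auto simp: U_def order_preserving_on_def)
  then have "y \<in> cube n l 1" by (auto simp: cube_def y_def)
  moreover have "y i \<le> y j" if "(i, j) \<in> P" for i j
  proof -
    have "U i \<subseteq> U j" using that tr by (auto simp: U_def dest: transD)
    then show ?thesis using that sub fU by (auto simp: y_def intro!: Max_mono)
  qed
  moreover have "y j = x j" if j: "j \<in> J" for j
  proof -
    have "Max (U j) = x j"
      using fU[of j] j re[of j] J x by (intro Max_eqI) (auto simp: U_def order_preserving_on_def)
    then show ?thesis using j J by (auto simp: y_def)
  qed
  ultimately show ?thesis by (auto simp: order_polytope_def)
qed

context
  fixes n :: nat and P :: "(nat \<times> nat) set" and l :: real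
  assumes P: "partial_order_on {1..n} P" and l: "0 \<le> l" "l \<le> 1"
begin

text \<open>For the grid points outside the polytope, at which the \<open>q\<close>-integral still
  evaluates its integrand; the inner integral is \<open>0\<close> there.\<close>

lemma slice_eq_empty:
  assumes "\<not> order_preserving_on l P {i<..n} x"
  shows "slice n (order_polytope (cube n l 1) P) i x = {}"
proof (rule ccontr)
  assume "slice n (order_polytope (cube n l 1) P) i x \<noteq> {}"
  then obtain y where y: "y \<in> order_polytope (cube n l 1) P" "\<forall>j\<in>{i<..n}. y j = x j"
    by (auto simp: slice_def)
  have "order_preserving_on l P {i<..n} y"
    using y(1) by (auto simp: order_preserving_on_def order_polytope_def cube_def PiE_iff)
  then have "order_preserving_on l P {i<..n} x"
    using y(2) by (auto simp: order_preserving_on_def)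
  with assms show False ..
qed

text \<open>Only fixed coordinates with larger index constrain coordinate \<open>i\<close>, because
  those with smaller index can be filled in afterwards. By transitivity of \<open>P\<close> no lower
  constraint exceeds an upper one.\<close>

lemma slice_eq_interval:
  assumes i: "i \<in> {1..n}" and x: "order_preserving_on l P {i<..n} x"
  defines "A \<equiv> insert l (x ` {j \<in> {i<..n}. (j, i) \<in> P})"
    and "B \<equiv> insert 1 (x ` {j \<in> {i<..n}. (i, j) \<in> P})"
  shows "slice n (order_polytope (cube n l 1) P) i x = {Max A..Min B}" "Max A \<le> Min B"
proof -
  have tr: "trans P"
    using P by (auto simp: partial_order_on_def preorder_on_def)
  have fin: "finite A" "A \<noteq> {}" "finite B" "B \<noteq> {}" by (auto simp: A_def B_def)
  have "a \<le> b" if ab: "a \<in> A" "b \<in> B" for a b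
  proof -
    have "x j \<le> x k" if "j \<in> {i<..n}" "k \<in> {i<..n}" "(j, i) \<in> P" "(i, k) \<in> P" for j k
    proof -
      have "(j, k) \<in> P" using that tr by (auto dest: transD)
      then show ?thesis using that x by (auto simp: order_preserving_on_def)
    qed
    then show ?thesis using ab x l by (auto simp: A_def B_def order_preserving_on_def)
  qed
  then show "Max A \<le> Min B" using fin by auto
  show "slice n (order_polytope (cube n l 1) P) i x = {Max A..Min B}"
  proof (intro equalityI subsetI)
    fix t assume "t \<in> slice n (order_polytope (cube n l 1) P) i x"
    then obtain y where y: "y \<in> order_polytope (cube n l 1) P" "\<forall>j\<in>{i<..n}. y j = x j" "t = y i"
      by (auto simp: slice_def)
    have range: "l \<le> y i" "y i \<le> 1" and mono: "\<And>j k. (j, k) \<in> P \<Longrightarrow> y j \<le> y k"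
      using y(1) i by (auto simp: order_polytope_def cube_def PiE_iff)
    have "x j \<le> t" if "j \<in> {i<..n}" "(j, i) \<in> P" for j
      using mono[OF that(2)] y(2,3) that(1) by simp
    then have "a \<le> t" if "a \<in> A" for a
      using that range y(3) by (auto simp: A_def)
    moreover have "t \<le> x j" if "j \<in> {i<..n}" "(i, j) \<in> P" for j
      using mono[OF that(2)] y(2,3) that(1) by simp
    then have "t \<le> b" if "b \<in> B" for b
      using that range y(3) by (auto simp: B_def)
    ultimately show "t \<in> {Max A..Min B}" using fin by auto
  next
    fix t assume t: "t \<in> {Max A..Min B}"
    have tA: "a \<le> t" if "a \<in> A" for a using that t fin by auto
    have tB: "t \<le> b" if "b \<in> B" for b using that t fin by auto
    define x' where "x' = x(i := t)"
    have "order_preserving_on l P {i..n} x'"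
      unfolding order_preserving_on_def
    proof (intro conjI ballI impI)
      fix j assume "j \<in> {i..n}"
      then show "l \<le> x' j" "x' j \<le> 1"
        using tA[of l] tB[of 1] x by (auto simp: x'_def A_def B_def order_preserving_on_def)
    next
      fix j k assume jk: "j \<in> {i..n}" "k \<in> {i..n}" "(j, k) \<in> P"
      show "x' j \<le> x' k"
      proof (cases "j = i \<or> k = i")
        case True
        then show ?thesis using jk tA[of "x j"] tB[of "x k"] by (auto simp: x'_def A_def B_def)
      next
        case False
        then show ?thesis using jk x by (auto simp: x'_def order_preserving_on_def)
      qed
    qed
    then obtain y where y: "y \<in> order_polytope (cube n l 1) P" "\<forall>j\<in>{i..n}. y j = x' j"
      using order_preserving_on_extend[OF P _ l(2), of "{i..n}" x'] i by auto
    then have "y i = t" "\<forall>j\<in>{i<..n}. y j = x j" using i by (auto simp: x'_def)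
    with y(1) show "t \<in> slice n (order_polytope (cube n l 1) P) i x"
      by (auto simp: slice_def)
  qed
qed

text \<open>Both ends of the slice are attained among \<open>l\<close>, \<open>1\<close> and fixed
  coordinates, hence are powers of \<open>q\<close> or \<open>0\<close>, and the half-open grid
  formula applies. Taking exponents reverses the inequalities: the excluded lower end gives
  \<open>k < y j\<close>, the included upper end \<open>y j \<le> k\<close>.\<close>

lemma q_iter_step:
  assumes q: "0 < q" "q < 1" and i: "Suc i \<le> n" and lp: "l = 0 \<or> (\<exists>M. l = q ^ M)"
    and x: "\<And>j. j \<in> {Suc i<..n} \<Longrightarrow> x j = q ^ y j"
    and op: "order_preserving_on l P {Suc i<..n} x"
    and bound: "\<And>k. \<bar>q_iter q n (order_polytope (cube n l 1) P) i (x(Suc i := q ^ k))\<bar> \<le> B"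
  shows "q_iter q n (order_polytope (cube n l 1) P) (Suc i) x
         = (1 - q) * (\<Sum>k. if l < q ^ k \<and> (\<forall>j\<in>{Suc i<..n}.
              ((j, Suc i) \<in> P \<longrightarrow> k < y j) \<and> ((Suc i, j) \<in> P \<longrightarrow> y j \<le> k))
            then q ^ k * q_iter q n (order_polytope (cube n l 1) P) i (x(Suc i := q ^ k)) else 0)"
proof -
  let ?D = "order_polytope (cube n l 1) P"
  define A where "A = insert l (x ` {j \<in> {Suc i<..n}. (j, Suc i) \<in> P})"
  define U where "U = insert 1 (x ` {j \<in> {Suc i<..n}. (Suc i, j) \<in> P})"
  have S: "slice n ?D (Suc i) x = {Max A..Min U}" "Max A \<le> Min U"
    using slice_eq_interval[OF _ op] i by (auto simp: A_def U_def)
  have fin: "finite A" "A \<noteq> {}" "finite U" "U \<noteq> {}" by (auto simp: A_def U_def)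
  have "Max A \<in> A" using fin by auto
  then have 1: "Max A = 0 \<or> (\<exists>v. Max A = q ^ v)"
    using lp x by (auto simp: A_def)
  have "Min U \<in> U" using fin by auto
  then have 2: "\<exists>u. Min U = q ^ u"
    using x by (auto simp: U_def intro: exI[of _ 0])
  have "q_iter q n ?D (Suc i) x = q_integral q (Max A) (Min U) (\<lambda>t. q_iter q n ?D i (x(Suc i := t)))"
    using S by (simp add: Let_def)
  also have "\<dots> = (1 - q) * (\<Sum>k. if Max A < q ^ k \<and> q ^ k \<le> Min U
      then q ^ k * q_iter q n ?D i (x(Suc i := q ^ k)) else 0)"
    by (rule q_integral_powers[where B = B, OF q _ 1 2 S(2)]) (rule bound)
  finally have *: "q_iter q n ?D (Suc i) x = (1 - q) * (\<Sum>k. if Max A < q ^ k \<and> q ^ k \<le> Min U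
      then q ^ k * q_iter q n ?D i (x(Suc i := q ^ k)) else 0)" .
  have "Max A < q ^ k \<and> q ^ k \<le> Min U \<longleftrightarrow> l < q ^ k \<and> (\<forall>j\<in>{Suc i<..n}.
      ((j, Suc i) \<in> P \<longrightarrow> k < y j) \<and> ((Suc i, j) \<in> P \<longrightarrow> y j \<le> k))" for k
  proof -
    have "Max A < q ^ k \<longleftrightarrow> l < q ^ k \<and> (\<forall>j\<in>{Suc i<..n}. (j, Suc i) \<in> P \<longrightarrow> x j < q ^ k)"
      using fin by (auto simp: A_def)
    moreover have "q ^ k \<le> Min U \<longleftrightarrow> (\<forall>j\<in>{Suc i<..n}. (Suc i, j) \<in> P \<longrightarrow> q ^ k \<le> x j)"
      using fin q by (auto simp: U_def power_le_one)
    ultimately show ?thesis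
      using x q by (auto simp: power_decreasing_iff power_strict_decreasing_iff)
  qed
  then show ?thesis unfolding * by presburger
qed

text \<open>The bound \<open>1\<close> reproduces itself under integration since
  \<open>(1 - q)\<close> times the sum of all \<open>q ^ k\<close> is \<open>1\<close>. It holds on
  the whole grid, inside the polytope or not, as the cancellation of tails requires.\<close>

lemma q_iter_bounds:
  assumes q: "0 < q" "q < 1" and lp: "l = 0 \<or> (\<exists>M. l = q ^ M)"
    and "i \<le> n" "\<And>j. j \<in> {i<..n} \<Longrightarrow> x j = q ^ y j"
  shows "q_iter q n (order_polytope (cube n l 1) P) i x \<in> {0..1}"
  using assms(4,5)
proof (induction i arbitrary: x y)
  case (Suc i)
  let ?D = "order_polytope (cube n l 1) P"
  have IH: "q_iter q n ?D i (x(Suc i := q ^ k)) \<in> {0..1}" for k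
    by (rule Suc.IH[of _ "y(Suc i := k)"]) (use Suc.prems in auto)
  show ?case
  proof (cases "order_preserving_on l P {Suc i<..n} x")
    case True
    have "\<bar>q_iter q n ?D i (x(Suc i := q ^ k))\<bar> \<le> 1" for k using IH[of k] by auto
    note step = q_iter_step[OF q Suc.prems(1) lp Suc.prems(2) True this]
    define f where "f k = (if l < q ^ k \<and> (\<forall>j\<in>{Suc i<..n}.
              ((j, Suc i) \<in> P \<longrightarrow> k < y j) \<and> ((Suc i, j) \<in> P \<longrightarrow> y j \<le> k))
            then q ^ k * q_iter q n ?D i (x(Suc i := q ^ k)) else 0)" for k
    have f: "0 \<le> f k" "f k \<le> q ^ k" for k
      using IH[of k] q by (auto simp: f_def mult_left_le)
    have g: "(\<lambda>k. q ^ k) sums (1 / (1 - q))" using q by (intro geometric_sums) auto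
    have sf: "summable f"
      by (rule summable_comparison_test'[OF sums_summable[OF g], of 0]) (use f in auto)
    have "suminf f \<le> 1 / (1 - q)"
      using suminf_le[OF f(2) sf sums_summable[OF g]] sums_unique[OF g] by simp
    moreover have "0 \<le> suminf f" by (rule suminf_nonneg[OF sf f(1)])
    ultimately have "(1 - q) * suminf f \<in> {0..1}"
      using q mult_left_mono[of "suminf f" "1 / (1 - q)" "1 - q"] by simp
    then show ?thesis using step unfolding f_def[symmetric] by simp
  next
    case False
    then show ?thesis by (simp add: slice_eq_empty Let_def)
  qed
qed simp

end

section \<open>The iterated integral over truncated polytopes and its limit\<close>

definition P_partition_on :: "(nat \<times> nat) set \<Rightarrow> nat set \<Rightarrow> (nat \<Rightarrow> nat) \<Rightarrow> bool" where
  "P_partition_on P J y \<longleftrightarrow>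
     (\<forall>i\<in>J. \<forall>j\<in>J. (i, j) \<in> P \<longrightarrow> y j \<le> y i \<and> (j < i \<longrightarrow> y j < y i))"

lemma order_preserving_on_power:
  assumes q: "0 < q" "q < 1" and y: "P_partition_on P J y"
    and x: "\<And>j. j \<in> J \<Longrightarrow> x j = q ^ y j" and l: "\<And>j. j \<in> J \<Longrightarrow> l \<le> q ^ y j"
  shows "order_preserving_on l P J x"
  using assms by (auto simp: order_preserving_on_def P_partition_on_def power_le_one power_decreasing_iff)

lemma P_partition_on_extend:
  assumes P: "partial_order_on {1..n} P" and y: "P_partition_on P {Suc i<..n} y"
    and k: "\<forall>j\<in>{Suc i<..n}. ((j, Suc i) \<in> P \<longrightarrow> k < y j) \<and> ((Suc i, j) \<in> P \<longrightarrow> y j \<le> k)"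
  shows "P_partition_on P {i<..n} (y(Suc i := k))"
  unfolding P_partition_on_def
proof (intro ballI impI)
  fix a b assume ab: "a \<in> {i<..n}" "b \<in> {i<..n}" "(a, b) \<in> P"
  consider "a = Suc i" | "b = Suc i" "a \<noteq> Suc i" | "a \<in> {Suc i<..n}" "b \<in> {Suc i<..n}"
    using ab by fastforce
  then show "(y(Suc i := k)) b \<le> (y(Suc i := k)) a \<and> (b < a \<longrightarrow> (y(Suc i := k)) b < (y(Suc i := k)) a)"
  proof cases
    case 1
    then show ?thesis using ab k by (cases "b = Suc i") auto
  next
    case 2
    then have "a \<in> {Suc i<..n}" using ab by auto
    then show ?thesis using ab k 2 by (auto intro: less_imp_le)
  next
    case 3
    then show ?thesis using ab y by (auto simp: P_partition_on_def)
  qed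
qed

text \<open>The exponents \<open>y\<close> of the outer variables are kept general for the
  induction: the partial integral sums over the completions of \<open>y\<close> to a
  \<open>P\<close>-partition, weighted by the integrated indices only.\<close>

lemma q_iter_finite:
  assumes P: "partial_order_on {1..n} P" and q: "0 < q" "q < 1"
    and "i \<le> n" "P_partition_on P {i<..n} y" "\<And>j. j \<in> {i<..n} \<Longrightarrow> x j = q ^ y j"
    "\<And>j. j \<in> {i<..n} \<Longrightarrow> y j < M"
  shows "q_iter q n (order_polytope (cube n (q ^ M) 1) P) i x
    = (1 - q) ^ i * (\<Sum>z | z \<in> P_partitions n P M \<and> (\<forall>j\<in>{i<..n}. z j = y j). q ^ (\<Sum>j\<in>{1..i}. z j))"
  using assms(4-7)
proof (induction i arbitrary: x y)
  case 0
  have sub: "P \<subseteq> {1..n} \<times> {1..n}"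
    using P by (auto simp: partial_order_on_def preorder_on_def)
  have "{z. z \<in> P_partitions n P M \<and> (\<forall>j\<in>{0<..n}. z j = y j)} = {\<lambda>j\<in>{1..n}. y j}"
  proof (intro equalityI subsetI)
    fix z assume "z \<in> {z. z \<in> P_partitions n P M \<and> (\<forall>j\<in>{0<..n}. z j = y j)}"
    then show "z \<in> {\<lambda>j\<in>{1..n}. y j}"
      by (auto simp: P_partitions_def fun_eq_iff PiE_iff extensional_def)
  next
    fix z assume "z \<in> {\<lambda>j\<in>{1..n}. y j}"
    moreover have "y j \<le> y i \<and> (j < i \<longrightarrow> y j < y i)" if "(i, j) \<in> P" for i j
      using that sub 0(2) by (fastforce simp: P_partition_on_def)
    ultimately show "z \<in> {z. z \<in> P_partitions n P M \<and> (\<forall>j\<in>{0<..n}. z j = y j)}"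
      using 0(4) sub by (fastforce simp: P_partitions_def)
  qed
  then show ?case by simp
next
  case (Suc i)
  let ?D = "order_polytope (cube n (q ^ M) 1) P"
  define Z where "Z i y = {z. z \<in> P_partitions n P M \<and> (\<forall>j\<in>{i<..n}. z j = y j)}" for i y
  have finZ: "finite (Z i y)" for i y
    by (rule finite_subset[OF _ finite_P_partitions[of n P M]]) (auto simp: Z_def)
  define C where "C k \<longleftrightarrow> (\<forall>j\<in>{Suc i<..n}. ((j, Suc i) \<in> P \<longrightarrow> k < y j) \<and> ((Suc i, j) \<in> P \<longrightarrow> y j \<le> k))" for k
  have l: "0 \<le> q ^ M" "q ^ M \<le> 1" using q by (auto simp: power_le_one)
  have lt: "q ^ M < q ^ k \<longleftrightarrow> k < M" for k
    using q by (simp add: power_strict_decreasing_iff)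
  have op: "order_preserving_on (q ^ M) P {Suc i<..n} x"
    using Suc.prems q
    by (intro order_preserving_on_power[OF q Suc.prems(2)]) (auto simp: power_decreasing_iff less_imp_le)
  have "q_iter q n ?D i (x(Suc i := q ^ k)) \<in> {0..1}" for k
    by (rule q_iter_bounds[OF P l q, of _ _ "y(Suc i := k)"]) (use Suc.prems in auto)
  then have bound: "\<bar>q_iter q n ?D i (x(Suc i := q ^ k))\<bar> \<le> 1" for k
    using abs_of_nonneg by simp
  have inner: "(if C k then q ^ k * q_iter q n ?D i (x(Suc i := q ^ k)) else 0)
      = (1 - q) ^ i * (\<Sum>z\<in>Z i (y(Suc i := k)). q ^ (\<Sum>j\<in>{1..Suc i}. z j))" if "k < M" for k
  proof (cases "C k")
    case True
    have pp: "P_partition_on P {i<..n} (y(Suc i := k))"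
      using P_partition_on_extend[OF P Suc.prems(2)] True by (simp add: C_def)
    have "q_iter q n ?D i (x(Suc i := q ^ k))
        = (1 - q) ^ i * (\<Sum>z\<in>Z i (y(Suc i := k)). q ^ (\<Sum>j\<in>{1..i}. z j))"
      unfolding Z_def by (rule Suc.IH[OF _ pp]) (use Suc.prems \<open>k < M\<close> in auto)
    moreover have "z (Suc i) = k" if "z \<in> Z i (y(Suc i := k))" for z
      using that Suc.prems(1) by (auto simp: Z_def)
    ultimately show ?thesis
      using True by (auto simp: sum_distrib_left power_add mult_ac intro!: sum.cong)
  next
    case False
    \<comment> \<open>A value \<open>k\<close> excluded by the slice has no completion either, so
      both sides vanish.\<close>
    have "Z i (y(Suc i := k)) = {}"
    proof (rule ccontr)
      assume "Z i (y(Suc i := k)) \<noteq> {}"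
      then obtain z where z: "z \<in> P_partitions n P M" "\<forall>j\<in>{i<..n}. z j = (y(Suc i := k)) j"
        by (auto simp: Z_def)
      have zk: "z (Suc i) = k" and zj: "\<And>j. j \<in> {Suc i<..n} \<Longrightarrow> z j = y j"
        using z(2) Suc.prems(1) by auto
      have mono: "z b \<le> z a \<and> (b < a \<longrightarrow> z b < z a)" if "(a, b) \<in> P" for a b
        using z(1) that by (simp add: P_partitions_def)
      have "C k"
        unfolding C_def
      proof (intro ballI conjI impI)
        fix j assume j: "j \<in> {Suc i<..n}"
        show "k < y j" if "(j, Suc i) \<in> P"
          using mono[OF that] j zk zj[OF j] by simp
        show "y j \<le> k" if "(Suc i, j) \<in> P"
          using mono[OF that] j zk zj[OF j] by simp
      qed
      with False show False by simp
    qed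
    with False show ?thesis by simp
  qed
  have "q_iter q n ?D (Suc i) x = (1 - q) * (\<Sum>k. if q ^ M < q ^ k \<and> C k
      then q ^ k * q_iter q n ?D i (x(Suc i := q ^ k)) else 0)"
    unfolding C_def
    by (rule q_iter_step[OF P l q Suc.prems(1) _ Suc.prems(3) op bound]) auto
  also have "(\<Sum>k. if q ^ M < q ^ k \<and> C k then q ^ k * q_iter q n ?D i (x(Suc i := q ^ k)) else 0)
      = (\<Sum>k<M. if q ^ M < q ^ k \<and> C k then q ^ k * q_iter q n ?D i (x(Suc i := q ^ k)) else 0)"
    by (rule suminf_finite) (auto simp: lt)
  also have "\<dots> = (\<Sum>k<M. (1 - q) ^ i * (\<Sum>z\<in>Z i (y(Suc i := k)). q ^ (\<Sum>j\<in>{1..Suc i}. z j)))"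
    by (rule sum.cong[OF refl]) (use inner in \<open>auto simp: lt\<close>)
  also have "\<dots> = (1 - q) ^ i * (\<Sum>k<M. \<Sum>z\<in>Z i (y(Suc i := k)). q ^ (\<Sum>j\<in>{1..Suc i}. z j))"
    by (simp add: sum_distrib_left)
  also have "(\<Sum>k<M. \<Sum>z\<in>Z i (y(Suc i := k)). q ^ (\<Sum>j\<in>{1..Suc i}. z j))
      = (\<Sum>z\<in>(\<Union>k<M. Z i (y(Suc i := k))). q ^ (\<Sum>j\<in>{1..Suc i}. z j))"
  proof (rule sum.UNION_disjoint[symmetric])
    show "\<forall>k\<in>{..<M}. \<forall>k'\<in>{..<M}. k \<noteq> k' \<longrightarrow> Z i (y(Suc i := k)) \<inter> Z i (y(Suc i := k')) = {}"
    proof (intro ballI impI equals0I)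
      fix k k' z assume "k \<noteq> k'" "z \<in> Z i (y(Suc i := k)) \<inter> Z i (y(Suc i := k'))"
      moreover have "Suc i \<in> {i<..n}" using Suc.prems(1) by simp
      ultimately show False by (force simp: Z_def)
    qed
  qed (use finZ in auto)
  also have "(\<Union>k<M. Z i (y(Suc i := k))) = Z (Suc i) y"
  proof (intro equalityI subsetI)
    fix z assume z: "z \<in> Z (Suc i) y"
    then have "z (Suc i) < M" using Suc.prems(1) by (auto simp: Z_def P_partitions_def PiE_iff)
    moreover have "z \<in> Z i (y(Suc i := z (Suc i)))" using z by (auto simp: Z_def)
    ultimately show "z \<in> (\<Union>k<M. Z i (y(Suc i := k)))" by blast
  qed (auto simp: Z_def)
  finally show ?case by (simp add: Z_def mult_ac)
qed

text \<open>Induction gives convergence of each term; Tannery's theorem, with the dominating series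
  of \<open>q ^ k\<close>, exchanges limit and sum.\<close>

lemma q_iter_tendsto:
  assumes P: "partial_order_on {1..n} P" and q: "0 < q" "q < 1"
    and "i \<le> n" "P_partition_on P {i<..n} y" "\<And>j. j \<in> {i<..n} \<Longrightarrow> x j = q ^ y j"
  shows "(\<lambda>M. q_iter q n (order_polytope (cube n (q ^ M) 1) P) i x)
    \<longlonglongrightarrow> q_iter q n (order_polytope (cube n 0 1) P) i x"
  using assms(4-6)
proof (induction i arbitrary: x y)
  case (Suc i)
  let ?D = "\<lambda>l. order_polytope (cube n l 1) P"
  define C where "C k \<longleftrightarrow> (\<forall>j\<in>{Suc i<..n}. ((j, Suc i) \<in> P \<longrightarrow> k < y j) \<and> ((Suc i, j) \<in> P \<longrightarrow> y j \<le> k))" for k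
  define f where "f l k = (if l < q ^ k \<and> C k then q ^ k * q_iter q n (?D l) i (x(Suc i := q ^ k)) else 0)" for l k
  have l: "0 \<le> q ^ M" "q ^ M \<le> 1" for M using q by (auto simp: power_le_one)
  have lt: "q ^ M < q ^ k \<longleftrightarrow> k < M" for k M
    using q by (simp add: power_strict_decreasing_iff)
  have bounds: "q_iter q n (?D l) i (x(Suc i := q ^ k)) \<in> {0..1}"
    if "0 \<le> l" "l \<le> 1" "l = 0 \<or> (\<exists>M. l = q ^ M)" for k l
    by (rule q_iter_bounds[OF P that(1,2) q that(3), of _ _ "y(Suc i := k)"]) (use Suc.prems in auto)
  have bound: "\<bar>q_iter q n (?D l) i (x(Suc i := q ^ k))\<bar> \<le> 1"
    if "0 \<le> l" "l \<le> 1" "l = 0 \<or> (\<exists>M. l = q ^ M)" for k l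
    using bounds[OF that, of k] by simp
  have step: "q_iter q n (?D l) (Suc i) x = (1 - q) * suminf (f l)"
    if "0 \<le> l" "l \<le> 1" "l = 0 \<or> (\<exists>M. l = q ^ M)" "\<And>j. j \<in> {Suc i<..n} \<Longrightarrow> l \<le> q ^ y j" for l
    unfolding f_def C_def
    by (rule q_iter_step[OF P that(1,2) q Suc.prems(1) that(3) Suc.prems(3)
          order_preserving_on_power[OF q Suc.prems(2)] bound[OF that(1-3)]])
      (use that Suc.prems in auto)
  have "(\<lambda>M. f (q ^ M) k) \<longlonglongrightarrow> f 0 k" for k
  proof (cases "C k")
    case True
    then have pp: "P_partition_on P {i<..n} (y(Suc i := k))"
      using P_partition_on_extend[OF P Suc.prems(2)] by (simp add: C_def)
    have "(\<lambda>M. q_iter q n (?D (q ^ M)) i (x(Suc i := q ^ k)))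
        \<longlonglongrightarrow> q_iter q n (?D 0) i (x(Suc i := q ^ k))"
      by (rule Suc.IH[OF _ pp]) (use Suc.prems in auto)
    then have "(\<lambda>M. q ^ k * q_iter q n (?D (q ^ M)) i (x(Suc i := q ^ k))) \<longlonglongrightarrow> f 0 k"
      using True q by (simp add: f_def tendsto_mult_left)
    then show ?thesis
    proof (rule Lim_transform_eventually)
      \<comment> \<open>For fixed \<open>k\<close> the truncation is no longer felt once
        \<open>M > k\<close>.\<close>
      show "eventually (\<lambda>M. q ^ k * q_iter q n (?D (q ^ M)) i (x(Suc i := q ^ k)) = f (q ^ M) k) sequentially"
        using eventually_gt_at_top[of k] by eventually_elim (use True in \<open>simp add: f_def lt\<close>)
    qed
  qed (simp add: f_def)
  moreover have "norm (f (q ^ M) k) \<le> q ^ k" for k M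
    using bound[of "q ^ M" k] l[of M] q by (auto simp: f_def abs_mult mult_left_le)
  then have "eventually (\<lambda>(k, M). norm (f (q ^ M) k) \<le> q ^ k) (sequentially \<times>\<^sub>F sequentially)"
    by (intro always_eventually) auto
  moreover have "summable (\<lambda>k. q ^ k)" using q by (intro summable_geometric) auto
  ultimately have "(\<lambda>M. suminf (f (q ^ M))) \<longlonglongrightarrow> suminf (f 0)"
    using tannerys_theorem[of "\<lambda>k M. f (q ^ M) k" "f 0" sequentially "\<lambda>k. q ^ k"]
      trivial_limit_sequentially by blast
  then have "(\<lambda>M. (1 - q) * suminf (f (q ^ M))) \<longlonglongrightarrow> q_iter q n (?D 0) (Suc i) x"
    using step[of 0] q by (simp add: tendsto_mult_left del: q_iter.simps)
  then show ?case
  proof (rule Lim_transform_eventually)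
    \<comment> \<open>The recursion for the truncated polytope applies once all fixed coordinates
      lie in its cube, that is, from the largest exponent on.\<close>
    define N where "N = Max (insert 0 (y ` {Suc i<..n}))"
    show "eventually (\<lambda>M. (1 - q) * suminf (f (q ^ M)) = q_iter q n (?D (q ^ M)) (Suc i) x) sequentially"
      using eventually_ge_at_top[of N]
    proof eventually_elim
      case (elim M)
      have "y j \<le> M" if "j \<in> {Suc i<..n}" for j
        using that elim by (auto simp: N_def)
      then have "q ^ M \<le> q ^ y j" if "j \<in> {Suc i<..n}" for j
        using that q by (simp add: power_decreasing_iff)
      then show ?case by (intro step[symmetric] l) auto
    qed
  qed
qed simp

lemma V_q_finite:
  assumes P: "partial_order_on {1..n} P" and q: "0 < q" "q < 1"
  shows "V_q q n (order_polytope (cube n (q ^ M) 1) P)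
    = (1 - q) ^ n * (\<Sum>z\<in>P_partitions n P M. q ^ (\<Sum>j\<in>{1..n}. z j))"
  unfolding V_q_def using q_iter_finite[OF P q, of n undefined "\<lambda>_. undefined" M]
  by (simp add: P_partition_on_def)

lemma V_q_tendsto:
  assumes P: "partial_order_on {1..n} P" and q: "0 < q" "q < 1"
  shows "(\<lambda>M. V_q q n (order_polytope (cube n (q ^ M) 1) P)) \<longlonglongrightarrow> V_q q n (order_polytope (cube n 0 1) P)"
  unfolding V_q_def using q_iter_tendsto[OF P q, of n undefined "\<lambda>_. undefined"]
  by (simp add: P_partition_on_def)

section \<open>Rational functions of \<open>q\<close>\<close>

lemma map_poly_of_rat_add:
  "map_poly of_rat (a + b) = (map_poly of_rat a + map_poly of_rat b :: real poly)"
  by (rule poly_eqI) (simp add: coeff_map_poly of_rat_add)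

lemma map_poly_of_rat_mult:
  "map_poly of_rat (a * b) = (map_poly of_rat a * map_poly of_rat b :: real poly)"
  by (rule poly_eqI) (simp add: coeff_map_poly coeff_mult of_rat_mult of_rat_sum)

lemma rational_in_qI:
  assumes "\<And>q::real. 0 < q \<Longrightarrow> q < 1 \<Longrightarrow> poly (map_poly of_rat b) q \<noteq> 0"
    and "\<And>q. 0 < q \<Longrightarrow> q < 1 \<Longrightarrow> c q = poly (map_poly of_rat a) q / poly (map_poly of_rat b) q"
  shows "rational_in_q c"
  unfolding rational_in_q_def using assms by (intro exI[of _ a] exI[of _ b]) auto

lemma rational_in_q_const: "rational_in_q (\<lambda>q. of_rat r)"
  by (rule rational_in_qI[of "[:1:]" _ "[:r:]"]) (auto simp: map_poly_pCons)

lemma rational_in_q_0: "rational_in_q (\<lambda>q. 0)"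
  and rational_in_q_1: "rational_in_q (\<lambda>q. 1)"
  using rational_in_q_const[of 0] rational_in_q_const[of 1] by auto

lemma rational_in_q_id: "rational_in_q (\<lambda>q. q)"
  by (rule rational_in_qI[of "[:1:]" _ "[:0, 1:]"]) (auto simp: map_poly_pCons)

lemma rational_in_q_add:
  assumes "rational_in_q f" "rational_in_q g"
  shows "rational_in_q (\<lambda>q. f q + g q)"
proof -
  obtain a b c d :: "rat poly" where *: "\<And>q. q \<in> {0<..<1} \<Longrightarrow> poly (map_poly of_rat b) q \<noteq> 0 \<and>
        f q = poly (map_poly of_rat a) q / poly (map_poly of_rat b) q"
    "\<And>q. q \<in> {0<..<1} \<Longrightarrow> poly (map_poly of_rat d) q \<noteq> 0 \<and>
        g q = poly (map_poly of_rat c) q / poly (map_poly of_rat d) q"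
    using assms unfolding rational_in_q_def by meson
  show ?thesis
    by (rule rational_in_qI[of "b * d" _ "a * d + c * b"])
      (use * in \<open>auto simp: map_poly_of_rat_add map_poly_of_rat_mult field_simps\<close>)
qed

lemma rational_in_q_mult:
  assumes "rational_in_q f" "rational_in_q g"
  shows "rational_in_q (\<lambda>q. f q * g q)"
proof -
  obtain a b c d :: "rat poly" where *: "\<And>q. q \<in> {0<..<1} \<Longrightarrow> poly (map_poly of_rat b) q \<noteq> 0 \<and>
        f q = poly (map_poly of_rat a) q / poly (map_poly of_rat b) q"
    "\<And>q. q \<in> {0<..<1} \<Longrightarrow> poly (map_poly of_rat d) q \<noteq> 0 \<and>
        g q = poly (map_poly of_rat c) q / poly (map_poly of_rat d) q"
    using assms unfolding rational_in_q_def by meson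
  show ?thesis
    by (rule rational_in_qI[of "b * d" _ "a * c"])
      (use * in \<open>auto simp: map_poly_of_rat_mult\<close>)
qed

text \<open>Since \<open>f\<close> has no zero in the interval, neither has its numerator, which may
  therefore serve as denominator.\<close>

lemma rational_in_q_inverse:
  assumes "rational_in_q f" "\<And>q. 0 < q \<Longrightarrow> q < 1 \<Longrightarrow> f q \<noteq> 0"
  shows "rational_in_q (\<lambda>q. inverse (f q))"
proof -
  obtain a b :: "rat poly" where *: "\<And>q. q \<in> {0<..<1} \<Longrightarrow> poly (map_poly of_rat b) q \<noteq> 0 \<and>
        f q = poly (map_poly of_rat a) q / poly (map_poly of_rat b) q"
    using assms(1) unfolding rational_in_q_def by meson
  show ?thesis
  proof (rule rational_in_qI[of a _ b])
    fix q :: real assume q: "0 < q" "q < 1"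
    then have "f q = poly (map_poly of_rat a) q / poly (map_poly of_rat b) q" using * by simp
    moreover have "f q \<noteq> 0" using assms(2) q .
    ultimately show "poly (map_poly of_rat a) q \<noteq> 0"
      "inverse (f q) = poly (map_poly of_rat b) q / poly (map_poly of_rat a) q" by auto
  qed
qed

lemma rational_in_q_divide:
  assumes "rational_in_q f" "rational_in_q g" "\<And>q. 0 < q \<Longrightarrow> q < 1 \<Longrightarrow> g q \<noteq> 0"
  shows "rational_in_q (\<lambda>q. f q / g q)"
  using rational_in_q_mult[OF assms(1) rational_in_q_inverse[OF assms(2,3)]]
  by (simp add: field_class.field_divide_inverse)

lemma rational_in_q_diff:
  assumes "rational_in_q f" "rational_in_q g"
  shows "rational_in_q (\<lambda>q. f q - g q)"
  using rational_in_q_add[OF assms(1) rational_in_q_mult[OF rational_in_q_const[of "-1"] assms(2)]]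
  by (simp add: of_rat_minus)

lemma rational_in_q_power: "rational_in_q f \<Longrightarrow> rational_in_q (\<lambda>q. f q ^ k)"
  by (induction k) (auto intro: rational_in_q_1 rational_in_q_mult)

lemma rational_in_q_sum:
  "(\<And>i. i \<in> A \<Longrightarrow> rational_in_q (f i)) \<Longrightarrow> rational_in_q (\<lambda>q. \<Sum>i\<in>A. f i q)"
  by (induction A rule: infinite_finite_induct) (auto intro: rational_in_q_0 rational_in_q_add)

lemma rational_in_q_prod:
  "(\<And>i. i \<in> A \<Longrightarrow> rational_in_q (f i)) \<Longrightarrow> rational_in_q (\<lambda>q. \<Prod>i\<in>A. f i q)"
  by (induction A rule: infinite_finite_induct) (auto intro: rational_in_q_1 rational_in_q_mult)

lemma rational_in_q_q_fact: "rational_in_q (\<lambda>q. q_fact q k)"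
  unfolding q_fact_def q_num_def
  by (intro rational_in_q_prod rational_in_q_divide rational_in_q_diff rational_in_q_power
      rational_in_q_1 rational_in_q_id) simp

definition rational_coeffs :: "(real \<Rightarrow> real poly) \<Rightarrow> bool" where
  "rational_coeffs p \<longleftrightarrow> (\<forall>k. rational_in_q (\<lambda>q. coeff (p q) k))"

lemma rational_coeffs_mult:
  assumes "rational_coeffs p" "rational_coeffs r"
  shows "rational_coeffs (\<lambda>q. p q * r q)"
  using assms unfolding rational_coeffs_def coeff_mult
  by (intro allI rational_in_q_sum rational_in_q_mult) auto

lemma rational_coeffs_const:
  assumes "rational_in_q f"
  shows "rational_coeffs (\<lambda>q. [:f q:])"
  unfolding rational_coeffs_def
proof
  fix k show "rational_in_q (\<lambda>q. coeff [:f q:] k)"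
    using assms by (cases k) (auto simp: rational_in_q_0)
qed

lemma rational_coeffs_smult:
  assumes "rational_in_q f" "rational_coeffs p"
  shows "rational_coeffs (\<lambda>q. smult (f q) (p q))"
  using assms unfolding rational_coeffs_def coeff_smult by (intro allI rational_in_q_mult) auto

lemma rational_coeffs_linear:
  assumes "rational_in_q f" "rational_in_q g"
  shows "rational_coeffs (\<lambda>q. [:f q, g q:])"
  unfolding rational_coeffs_def
proof
  fix k show "rational_in_q (\<lambda>q. coeff [:f q, g q:] k)"
  proof (cases k)
    case (Suc j)
    then show ?thesis using assms by (cases j) (auto simp: rational_in_q_0)
  qed (use assms in simp)
qed

lemma rational_coeffs_sum:
  "(\<And>i. i \<in> A \<Longrightarrow> rational_coeffs (f i)) \<Longrightarrow> rational_coeffs (\<lambda>q. \<Sum>i\<in>A. f i q)"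
  unfolding rational_coeffs_def coeff_sum by (auto intro: rational_in_q_sum)

lemma rational_coeffs_prod:
  "(\<And>i. i \<in> A \<Longrightarrow> rational_coeffs (f i)) \<Longrightarrow> rational_coeffs (\<lambda>q. \<Prod>i\<in>A. f i q)"
proof (induction A rule: infinite_finite_induct)
  case (insert x F)
  then show ?case by (simp add: rational_coeffs_mult)
qed (use rational_coeffs_const[OF rational_in_q_1] in \<open>simp_all add: one_pCons\<close>)

lemma rational_coeffs_power: "rational_coeffs p \<Longrightarrow> rational_coeffs (\<lambda>q. p q ^ k)"
  using rational_coeffs_prod[of "{..<k}" "\<lambda>_. p"] by simp

section \<open>Homogenization of polynomials\<close>

text \<open>A binary form is stored as a polynomial in one variable. Its degree \<open>n\<close> is
  prescribed rather than read off from \<open>R\<close>, so that forms can be added and the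
  coefficient of \<open>x ^ n\<close> is always \<open>coeff R n\<close>.\<close>

definition homogenize :: "nat \<Rightarrow> real poly \<Rightarrow> real \<Rightarrow> real \<Rightarrow> real" where
  "homogenize n R x y = (\<Sum>k\<le>n. coeff R k * x ^ k * y ^ (n - k))"

lemma homogenize_linear_times:
  assumes "degree R \<le> n"
  shows "homogenize (Suc n) ([:a, 1:] * R) x y = (x + a * y) * homogenize n R x y"
proof -
  \<comment> \<open>This removes the only term from which no factor \<open>y\<close> could be
    extracted.\<close>
  have 0: "coeff R (Suc n) = 0" using assms by (simp add: coeff_eq_0)
  have c: "coeff ([:a, 1:] * R) k = a * coeff R k + (case k of 0 \<Rightarrow> 0 | Suc j \<Rightarrow> coeff R j)" for k
    by (simp add: coeff_pCons)
  have "homogenize (Suc n) ([:a, 1:] * R) x y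
      = a * (\<Sum>k\<le>Suc n. coeff R k * x ^ k * y ^ (Suc n - k))
        + (\<Sum>k\<le>Suc n. (case k of 0 \<Rightarrow> 0 | Suc j \<Rightarrow> coeff R j) * x ^ k * y ^ (Suc n - k))"
    unfolding homogenize_def c by (simp only: sum_distrib_left sum.distrib[symmetric] algebra_simps)
  also have "(\<Sum>k\<le>Suc n. coeff R k * x ^ k * y ^ (Suc n - k)) = y * homogenize n R x y"
    unfolding homogenize_def sum_distrib_left by (simp add: 0 Suc_diff_le mult_ac)
  also have "(\<Sum>k\<le>Suc n. (case k of 0 \<Rightarrow> 0 | Suc j \<Rightarrow> coeff R j) * x ^ k * y ^ (Suc n - k))
      = x * homogenize n R x y"
    unfolding homogenize_def sum_distrib_left by (subst sum.atMost_Suc_shift) (simp add: mult_ac)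
  finally show ?thesis by (simp add: algebra_simps)
qed

lemma homogenize_prod:
  "homogenize n (\<Prod>i\<in>{1..n}. [:a i, 1:]) x y = (\<Prod>i\<in>{1..n}. x + a i * y)"
proof (induction n)
  case (Suc n)
  have "degree (\<Prod>i\<in>{1..n}. [:a i, 1:]) \<le> n"
    using degree_prod_sum_le[of "{1..n}" "\<lambda>i. [:a i, 1:]"] by simp
  from homogenize_linear_times[OF this] Suc show ?case
    by (simp add: mult.commute)
qed (simp add: homogenize_def)

lemma homogenize_sum: "homogenize n (\<Sum>i\<in>A. R i) x y = (\<Sum>i\<in>A. homogenize n (R i) x y)"
  unfolding homogenize_def coeff_sum sum_distrib_right by (rule sum.swap)

lemma homogenize_smult: "homogenize n (smult c R) x y = c * homogenize n R x y"
  unfolding homogenize_def by (simp add: sum_distrib_left mult_ac)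

lemma tendsto_homogenize:
  assumes "(f \<longlongrightarrow> x) F" "(g \<longlongrightarrow> 0) F"
  shows "((\<lambda>t. homogenize n R (f t) (g t)) \<longlongrightarrow> coeff R n * x ^ n) F"
proof -
  have "((\<lambda>t. homogenize n R (f t) (g t)) \<longlongrightarrow> (\<Sum>k\<le>n. coeff R k * x ^ k * 0 ^ (n - k))) F"
    unfolding homogenize_def by (intro tendsto_intros assms)
  also have "(\<Sum>k\<le>n. coeff R k * x ^ k * 0 ^ (n - k)) = (\<Sum>k\<le>n. if k = n then coeff R n * x ^ n else 0)"
    by (intro sum.cong) auto
  finally show ?thesis by simp
qed

text \<open>For \<open>s = 1 - q\<close> and \<open>t = [m]_q\<close> the second argument is
  \<open>q^m\<close>.\<close>

lemma poly_homogeneous: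
  "poly (\<Sum>k\<le>n. smult (coeff R k) ([:0, 1:] ^ k * [:1, - s:] ^ (n - k))) t
   = homogenize n R t (1 - s * t)"
  by (simp add: poly_sum homogenize_def algebra_simps)

text \<open>The polynomial is the form restricted to the line of points
  \<open>(t, 1 - s * t)\<close>; its coefficient of degree \<open>n\<close> is the form at the
  direction \<open>(1, - s)\<close> of that line.\<close>

lemma coeff_homogeneous:
  "coeff (\<Sum>k\<le>n. smult (coeff R k) ([:0, 1:] ^ k * [:1, - s:] ^ (n - k))) n
   = homogenize n R 1 (- s)"
proof -
  have "coeff ([:0, 1:] ^ k * [:1, - s:] ^ (n - k)) n = (- s) ^ (n - k)" if "k \<le> n" for k
    using that coeff_monom_mult[of 1 k "[:1, - s:] ^ (n - k)" n]
      coeff_linear_poly_power[of "n - k" "n - k" 1 "- s"]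
    by (simp add: monom_altdef)
  then show ?thesis by (simp add: coeff_sum homogenize_def)
qed

lemma degree_homogeneous_le:
  "degree (\<Sum>k\<le>n. smult (c k) ([:0, 1:] ^ k * [:1, - s:] ^ (n - k)) :: real poly) \<le> n"
proof (intro degree_sum_le)
  fix k assume k: "k \<in> {..n}"
  have "degree (smult (c k) ([:0, 1:] ^ k * [:1, - s:] ^ (n - k)))
      \<le> degree ([:0, 1:] ^ k * [:1, - s:] ^ (n - k))"
    by (rule degree_smult_le)
  also have "\<dots> \<le> degree ([:0, 1 :: real:] ^ k) + degree ([:1, - s:] ^ (n - k))"
    by (rule degree_mult_le)
  also have "\<dots> \<le> 1 * k + 1 * (n - k)"
    by (intro add_mono order.trans[OF degree_power_le] mult_right_mono) auto
  finally show "degree (smult (c k) ([:0, 1:] ^ k * [:1, - s:] ^ (n - k))) \<le> n"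
    using k by simp
qed simp

section \<open>The polynomial in \<open>[m]\<^sub>q\<close>\<close>

text \<open>Since \<open>[m + s]\<^sub>q = [m]\<^sub>q + q\<^sup>m [s]\<^sub>q\<close> also for negative \<open>s\<close>, replacing each factor
  \<open>[m + i - d]\<^sub>q\<close> of the \<open>q\<close>-binomial coefficient by \<open>t + [i - d]\<^sub>q\<close> dehomogenizes the sum over
  the linear extensions with respect to \<open>[m]\<^sub>q\<close> and \<open>q\<^sup>m\<close>.\<close>

definition ehrhart_poly :: "nat \<Rightarrow> (nat \<times> nat) set \<Rightarrow> real \<Rightarrow> real poly" where
  "ehrhart_poly n P q = (\<Sum>t\<in>linear_extensions n P. smult (q ^ maj t / q_fact q n)
     (\<Prod>i\<in>{1..n}. [:(1 - q ^ i / q ^ des t) / (1 - q), 1:]))"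

lemma homogenize_ehrhart_poly:
  "homogenize n (ehrhart_poly n P q) x y = (\<Sum>t\<in>linear_extensions n P. q ^ maj t / q_fact q n *
     (\<Prod>i\<in>{1..n}. x + (1 - q ^ i / q ^ des t) / (1 - q) * y))"
  by (simp only: ehrhart_poly_def homogenize_sum homogenize_smult homogenize_prod)

lemma homogenize_ehrhart_poly_q_num:
  assumes q: "0 < q" "q < 1"
  shows "homogenize n (ehrhart_poly n P q) (q_num q m) (q ^ m)
    = (\<Sum>t\<in>linear_extensions n P. q ^ maj t * q_binomial q (m + n - des t) n)"
  unfolding homogenize_ehrhart_poly
proof (rule sum.cong)
  fix t assume "t \<in> linear_extensions n P"
  note t = linear_extensionsD[OF this]
  have "q_num q m + (1 - q ^ i / q ^ des t) / (1 - q) * q ^ m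
      = (1 - q ^ m * q ^ i / q ^ des t) / (1 - q)" for i
    by (simp add: q_num_def diff_divide_distrib add_divide_distrib algebra_simps)
  then show "q ^ maj t / q_fact q n *
      (\<Prod>i\<in>{1..n}. q_num q m + (1 - q ^ i / q ^ des t) / (1 - q) * q ^ m)
      = q ^ maj t * q_binomial q (m + n - des t) n"
    using q_binomial_prod[OF q t(4), of m] by simp
qed simp

text \<open>Here every linear factor collapses to \<open>q ^ i / q ^ des t\<close>, so the
  contributions of the linear extensions are all positive and cannot cancel. This gives degree
  exactly \<open>n\<close>.\<close>

lemma homogenize_ehrhart_poly_pos:
  assumes q: "0 < q" "q < 1" and P: "partial_order_on {1..n} P"
  shows "homogenize n (ehrhart_poly n P q) 1 (- (1 - q)) > 0"
  unfolding homogenize_ehrhart_poly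
proof (rule sum_pos[OF finite_linear_extensions linear_extensions_nonempty[OF P]])
  fix t
  have "1 + (1 - q ^ i / q ^ des t) / (1 - q) * - (1 - q) = q ^ i / q ^ des t" for i
    using q by (simp add: field_simps)
  then show "0 < q ^ maj t / q_fact q n *
      (\<Prod>i\<in>{1..n}. 1 + (1 - q ^ i / q ^ des t) / (1 - q) * - (1 - q))"
    using q q_fact_pos[OF q, of n] by (auto intro!: mult_pos_pos divide_pos_pos prod_pos)
qed

lemma rational_coeffs_ehrhart_poly: "rational_coeffs (ehrhart_poly n P)"
  unfolding ehrhart_poly_def
  by (intro rational_coeffs_sum rational_coeffs_smult rational_coeffs_prod rational_coeffs_linear
      rational_in_q_divide rational_in_q_diff rational_in_q_power rational_in_q_1 rational_in_q_id
      rational_in_q_q_fact)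
    (auto simp: q_fact_pos[THEN less_imp_neq, symmetric])

lemma rational_coeffs_homogeneous:
  assumes "rational_coeffs Q"
  shows "rational_coeffs (\<lambda>q. \<Sum>k\<le>n. smult (coeff (Q q) k) ([:0, 1:] ^ k * [:1, - (1 - q):] ^ (n - k)))"
proof -
  have "rational_in_q (\<lambda>q. - (1 - q))"
    using rational_in_q_diff[OF rational_in_q_id rational_in_q_1] by simp
  moreover have "rational_in_q (\<lambda>q. coeff (Q q) k)" for k
    using assms by (simp add: rational_coeffs_def)
  ultimately show ?thesis
    by (intro rational_coeffs_sum rational_coeffs_smult rational_coeffs_mult rational_coeffs_power
        rational_coeffs_linear rational_in_q_0 rational_in_q_1)
qed

theorem theorem9p3:
  fixes n :: nat and P :: "(nat \<times> nat) set" and \<omega> :: "nat \<Rightarrow> nat"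
  assumes poset: "partial_order_on {1..n} P"
    and labeling: "\<And>i. i \<in> {1..n} \<Longrightarrow> \<omega> i = i"
  shows "(\<forall>q::real. 0 < q \<and> q < 1 \<longrightarrow> (\<forall>m::nat.
            E_q q n (Delta n P) m
              = 1 / (1 - q) ^ n * V_q q n (order_polytope (cube n (q ^ (m + 1)) 1) P) \<and>
            E_q q n (Delta n P) m
              = (\<Sum>\<pi>\<in>Jordan_Hoelder n P \<omega>. q ^ maj \<pi> * q_binomial q (m + n - des \<pi>) n)))
       \<and> (\<exists>(p :: real \<Rightarrow> real poly) (c :: nat \<Rightarrow> real \<Rightarrow> real).
            (\<forall>k. rational_in_q (\<lambda>q. coeff (p q) k)) \<and>
            (\<forall>k\<le>n. rational_in_q (c k)) \<and>
            (\<forall>q::real. 0 < q \<and> q < 1 \<longrightarrow>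
               degree (p q) = n \<and>
               (\<forall>m::nat. E_q q n (Delta n P) m = poly (p q) (q_num q m)) \<and>
               homogeneous_coeffs q n (p q) (\<lambda>k. c k q) \<and>
               c n q = V_q q n (order_polytope (cube n 0 1) P)))"
proof -
  have sub: "P \<subseteq> {1..n} \<times> {1..n}"
    using poset by (auto simp: partial_order_on_def preorder_on_def)
  have "map \<omega> t = t" if "t \<in> linear_extensions n P" for t
    using linear_extensionsD(2)[OF that] labeling by (intro map_idI) auto
  then have JH: "Jordan_Hoelder n P \<omega> = linear_extensions n P"
    by (simp add: Jordan_Hoelder_def)
  have E_V: "E_q q n (Delta n P) m
      = 1 / (1 - q) ^ n * V_q q n (order_polytope (cube n (q ^ (m + 1)) 1) P)"
    if q: "0 < q" "q < 1" for q :: real and m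
    using q by (simp add: E_q_Delta[OF sub q(1)] V_q_finite[OF poset q] del: power_Suc)
  have E_JH: "E_q q n (Delta n P) m
      = (\<Sum>\<pi>\<in>linear_extensions n P. q ^ maj \<pi> * q_binomial q (m + n - des \<pi>) n)"
    if q: "0 < q" "q < 1" for q :: real and m
    by (simp only: E_q_Delta[OF sub q(1)] sum_P_partitions[OF sub q])
  define Q where "Q = ehrhart_poly n P"
  define p where "p = (\<lambda>q. \<Sum>k\<le>n. smult (coeff (Q q) k) ([:0, 1:] ^ k * [:1, - (1 - q):] ^ (n - k)))"
  have E_Q: "E_q q n (Delta n P) m = homogenize n (Q q) (q_num q m) (q ^ m)"
    if q: "0 < q" "q < 1" for q :: real and m
    unfolding Q_def homogenize_ehrhart_poly_q_num[OF q] by (rule E_JH[OF q])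
  have rat: "rational_coeffs Q" "rational_coeffs p"
    unfolding p_def Q_def by (intro rational_coeffs_homogeneous rational_coeffs_ehrhart_poly)+
  have "degree (p q) = n" if q: "0 < q" "q < 1" for q :: real
  proof (rule antisym)
    show "degree (p q) \<le> n" unfolding p_def by (rule degree_homogeneous_le)
    have "coeff (p q) n \<noteq> 0"
      using homogenize_ehrhart_poly_pos[OF q poset]
      unfolding p_def coeff_homogeneous Q_def by linarith
    then show "n \<le> degree (p q)" by (rule le_degree)
  qed
  moreover have "E_q q n (Delta n P) m = poly (p q) (q_num q m)"
    if q: "0 < q" "q < 1" for q :: real and m
  proof -
    have "1 - (1 - q) * q_num q m = q ^ m" using q by (simp add: q_num_def)
    then show ?thesis by (simp only: p_def poly_homogeneous E_Q[OF q])
  qed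
  moreover have "coeff (Q q) n = V_q q n (order_polytope (cube n 0 1) P)"
    if q: "0 < q" "q < 1" for q :: real
  proof -
    \<comment> \<open>As \<open>m\<close> grows, \<open>q^m\<close> tends to \<open>0\<close> and
      kills all terms of the form but the top one, while \<open>[m]_q\<close> tends to
      \<open>1 / (1 - q)\<close>. That power of \<open>1 - q\<close> is the normalization in front
      of the \<open>q\<close>-volume.\<close>
    have qm: "(\<lambda>m. q ^ m) \<longlonglongrightarrow> 0" using q by (intro LIMSEQ_power_zero) auto
    have "(\<lambda>m. q_num q m) \<longlonglongrightarrow> (1 - 0) / (1 - q)"
      unfolding q_num_def using q by (intro tendsto_intros qm) auto
    from tendsto_homogenize[OF this qm, of n "Q q"]
    have "(\<lambda>m. E_q q n (Delta n P) m) \<longlonglongrightarrow> coeff (Q q) n * ((1 - 0) / (1 - q)) ^ n"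
      unfolding E_Q[OF q] .
    moreover have "(\<lambda>m. E_q q n (Delta n P) m)
        \<longlonglongrightarrow> 1 / (1 - q) ^ n * V_q q n (order_polytope (cube n 0 1) P)"
      unfolding E_V[OF q] Suc_eq_plus1[symmetric]
      by (intro tendsto_mult_left LIMSEQ_Suc V_q_tendsto poset q)
    ultimately show ?thesis
      using LIMSEQ_unique q by (fastforce simp: power_divide)
  qed
  moreover have "homogeneous_coeffs q n (p q) (\<lambda>k. coeff (Q q) k)" for q
    by (simp add: homogeneous_coeffs_def p_def)
  ultimately show ?thesis
    using E_V E_JH rat unfolding JH rational_coeffs_def
    by (intro conjI exI[of _ p] exI[of _ "\<lambda>k q. coeff (Q q) k"]) auto
qed

end
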